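(* Let $V$ be a finite-dimensional real inner product space, let $\mathfrak g\subseteq\mathfrak{so}(V)$ be a Lie subalgebra with inner product $\langle L,X\rangle=-\frac12\operatorname{tr}_V(LX)$, and let $N=\dim\mathfrak g$. Let $T:\mathfrak g\to\mathfrak g$ be any self-adjoint endomorphism. Choose an orthonormal eigenbasis $\eta_1,\dots,\eta_N$ of $\mathfrak g$ with $T\eta_i=\lambda_i\eta_i$ and $\lambda_1\le\cdots\le\lambda_N$. Then $$\sum_{i=1}^{l}\|\eta_i\cdot T\|^2\le 6\,l\,\|T\|^2\qquad\text{for all }1\le l\le N.$$ In particular, the estimate holds for $\mathfrak g=\mathfrak{so}(n)$, $\mathfrak{su}(n)$ and $\mathfrak{sp}(n)$, regarded as subalgebras of $\mathfrak{so}(\mathbb R^n)$, $\mathfrak{so}(\mathbb C^n)$ and $\mathfrak{so}(\mathbb H^n)$ (real skew-adjoint endomorphisms of the underlying real vector spaces) with the induced inner product. No trace condition or curvature identity is imposed on $T$.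
   Context: $\mathfrak{so}(V)$ is the Lie algebra of skew-adjoint endomorphisms of $V$ with bracket $[L,K]=LK-KL$; a Lie subalgebra is a linear subspace closed under the bracket. For $L\in\mathfrak g$, $\operatorname{ad}_L(X)=[L,X]$ on $\mathfrak g$. For a self-adjoint endomorphism $T$ of $\mathfrak g$, $L\cdot T=[\operatorname{ad}_L,T]$, i.e. $(L\cdot T)X=[L,TX]-T[L,X]$. $\|\cdot\|$ denotes the Hilbert-Schmidt norm of endomorphisms of $\mathfrak g$, $\|A\|^2=\operatorname{tr}(A^*A)$. $\mathfrak{so}(n)$ consists of real skew-symmetric matrices, $\mathfrak{su}(n)$ of complex trace-free skew-Hermitian matrices, and $\mathfrak{sp}(n)$ of quaternionic skew-Hermitian matrices. *)

theory Defs
  imports "HOL-Analysis.Analysis"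
begin

section \<open>Lie subalgebras of \<open>so(V)\<close>\<close>

text \<open>
  Endomorphisms of a Euclidean space \<open>V\<close> are elements of the real vector space
  \<^typ>\<open>'v::euclidean_space \<Rightarrow>\<^sub>L 'v\<close>, so that \<^const>\<open>subspace\<close>, \<^const>\<open>span\<close> and \<^const>\<open>dim\<close> apply to
  sets of endomorphisms.
\<close>

definition skew_endos :: "('v::euclidean_space \<Rightarrow>\<^sub>L 'v) set"
  where "skew_endos = {L. \<forall>x y. blinfun_apply L x \<bullet> y = - (x \<bullet> blinfun_apply L y)}"

definition lie_bracket ::
    "('v::euclidean_space \<Rightarrow>\<^sub>L 'v) \<Rightarrow> ('v \<Rightarrow>\<^sub>L 'v) \<Rightarrow> ('v \<Rightarrow>\<^sub>L 'v)"
  where "lie_bracket L K = (L o\<^sub>L K) - (K o\<^sub>L L)"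

definition lie_subalgebra :: "('v::euclidean_space \<Rightarrow>\<^sub>L 'v) set \<Rightarrow> bool"
  where "lie_subalgebra G \<longleftrightarrow>
    subspace G \<and> G \<subseteq> skew_endos \<and> (\<forall>L\<in>G. \<forall>K\<in>G. lie_bracket L K \<in> G)"

text \<open>
  The trace of an endomorphism \<open>f\<close> of a finite-dimensional subspace \<open>S\<close>: the sum of the diagonal
  coefficients with respect to some basis of \<open>S\<close>. Only the values of \<open>f\<close> on \<open>S\<close> matter.
\<close>

definition trace_on :: "'a::real_vector set \<Rightarrow> ('a \<Rightarrow> 'a) \<Rightarrow> real"
  where "trace_on S f =
    (let B = (SOME B. independent B \<and> span B = S) in \<Sum>b\<in>B. representation B (f b) b)"

definition lie_inner :: "('v::euclidean_space \<Rightarrow>\<^sub>L 'v) \<Rightarrow> ('v \<Rightarrow>\<^sub>L 'v) \<Rightarrow> real"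
  where "lie_inner L X = - (1/2) * trace_on UNIV (blinfun_apply (L o\<^sub>L X))"


section \<open>Endomorphisms of a Lie subalgebra\<close>

text \<open>
  An endomorphism of \<open>G\<close> is a function on the ambient type that is constrained on \<open>G\<close> only.
\<close>

definition endomorphism_on :: "'a::real_vector set \<Rightarrow> ('a \<Rightarrow> 'a) \<Rightarrow> bool"
  where "endomorphism_on G A \<longleftrightarrow>
    (\<forall>X\<in>G. A X \<in> G) \<and>
    (\<forall>X\<in>G. \<forall>Y\<in>G. A (X + Y) = A X + A Y) \<and>
    (\<forall>c. \<forall>X\<in>G. A (c *\<^sub>R X) = c *\<^sub>R A X)"

definition self_adjoint_on ::
    "('v::euclidean_space \<Rightarrow>\<^sub>L 'v) set \<Rightarrow> (('v \<Rightarrow>\<^sub>L 'v) \<Rightarrow> ('v \<Rightarrow>\<^sub>L 'v)) \<Rightarrow> bool"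
  where "self_adjoint_on G T \<longleftrightarrow>
    endomorphism_on G T \<and> (\<forall>X\<in>G. \<forall>Y\<in>G. lie_inner (T X) Y = lie_inner X (T Y))"

definition adjoint_on ::
    "('v::euclidean_space \<Rightarrow>\<^sub>L 'v) set \<Rightarrow> (('v \<Rightarrow>\<^sub>L 'v) \<Rightarrow> ('v \<Rightarrow>\<^sub>L 'v)) \<Rightarrow> ('v \<Rightarrow>\<^sub>L 'v) \<Rightarrow> ('v \<Rightarrow>\<^sub>L 'v)"
  where "adjoint_on G A X = (THE Z. Z \<in> G \<and> (\<forall>Y\<in>G. lie_inner Z Y = lie_inner X (A Y)))"

definition hs_norm ::
    "('v::euclidean_space \<Rightarrow>\<^sub>L 'v) set \<Rightarrow> (('v \<Rightarrow>\<^sub>L 'v) \<Rightarrow> ('v \<Rightarrow>\<^sub>L 'v)) \<Rightarrow> real"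
  where "hs_norm G A = sqrt (trace_on G (adjoint_on G A \<circ> A))"

definition lie_act ::
    "('v::euclidean_space \<Rightarrow>\<^sub>L 'v) \<Rightarrow> (('v \<Rightarrow>\<^sub>L 'v) \<Rightarrow> ('v \<Rightarrow>\<^sub>L 'v)) \<Rightarrow> ('v \<Rightarrow>\<^sub>L 'v) \<Rightarrow> ('v \<Rightarrow>\<^sub>L 'v)"
  where "lie_act L T X = lie_bracket L (T X) - T (lie_bracket L X)"

text \<open>Eigenvectors and eigenvalues are indexed by \<open>1, \<dots>, dim G\<close>; other indices are irrelevant.\<close>

definition ordered_eigenbasis ::
    "('v::euclidean_space \<Rightarrow>\<^sub>L 'v) set \<Rightarrow> (('v \<Rightarrow>\<^sub>L 'v) \<Rightarrow> ('v \<Rightarrow>\<^sub>L 'v)) \<Rightarrow>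
     (nat \<Rightarrow> ('v \<Rightarrow>\<^sub>L 'v)) \<Rightarrow> (nat \<Rightarrow> real) \<Rightarrow> bool"
  where "ordered_eigenbasis G T \<eta> \<mu> \<longleftrightarrow>
    (\<forall>i\<in>{1..dim G}. \<forall>j\<in>{1..dim G}. lie_inner (\<eta> i) (\<eta> j) = (if i = j then 1 else 0)) \<and>
    span (\<eta> ` {1..dim G}) = G \<and>
    (\<forall>i\<in>{1..dim G}. T (\<eta> i) = \<mu> i *\<^sub>R \<eta> i) \<and>
    mono_on {1..dim G} \<mu>"


section \<open>Quaternions\<close>

datatype quat = Quat (qRe: real) (qI: real) (qJ: real) (qK: real)

lemma quat_eq_iff: "x = y \<longleftrightarrow> qRe x = qRe y \<and> qI x = qI y \<and> qJ x = qJ y \<and> qK x = qK y"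
  by (cases x; cases y) simp

instantiation quat :: ring_1
begin

definition zero_quat_def: "0 = Quat 0 0 0 0"
definition one_quat_def: "1 = Quat 1 0 0 0"
definition plus_quat_def: "x + y = Quat (qRe x + qRe y) (qI x + qI y) (qJ x + qJ y) (qK x + qK y)"
definition uminus_quat_def: "- x = Quat (- qRe x) (- qI x) (- qJ x) (- qK x)"
definition minus_quat_def: "x - y = Quat (qRe x - qRe y) (qI x - qI y) (qJ x - qJ y) (qK x - qK y)"
definition times_quat_def:
  "x * y = Quat
     (qRe x * qRe y - qI x * qI y - qJ x * qJ y - qK x * qK y)
     (qRe x * qI y + qI x * qRe y + qJ x * qK y - qK x * qJ y)
     (qRe x * qJ y - qI x * qK y + qJ x * qRe y + qK x * qI y)
     (qRe x * qK y + qI x * qJ y - qJ x * qI y + qK x * qRe y)"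

instance
  by standard
    (simp_all add: quat_eq_iff zero_quat_def one_quat_def plus_quat_def uminus_quat_def
      minus_quat_def times_quat_def algebra_simps)

end

instantiation quat :: real_algebra_1
begin

definition scaleR_quat_def: "r *\<^sub>R x = Quat (r * qRe x) (r * qI x) (r * qJ x) (r * qK x)"

instance
  by standard
    (simp_all add: quat_eq_iff plus_quat_def times_quat_def scaleR_quat_def algebra_simps)

end

instantiation quat :: real_inner
begin

definition inner_quat_def: "x \<bullet> y = qRe x * qRe y + qI x * qI y + qJ x * qJ y + qK x * qK y"
definition norm_quat_def: "norm (x::quat) = sqrt (x \<bullet> x)"
definition sgn_quat_def: "sgn (x::quat) = x /\<^sub>R norm x"
definition dist_quat_def: "dist (x::quat) y = norm (x - y)"
definition uniformity_quat_def [code del]: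
  "(uniformity :: (quat \<times> quat) filter) = (INF e\<in>{0 <..}. principal {(x, y). dist x y < e})"
definition open_quat_def [code del]:
  "open (U :: quat set) \<longleftrightarrow> (\<forall>x\<in>U. eventually (\<lambda>(x', y). x' = x \<longrightarrow> y \<in> U) uniformity)"

instance
proof
  fix x y z :: quat and r :: real
  show "dist x y = norm (x - y)" "sgn x = x /\<^sub>R norm x" "norm x = sqrt (x \<bullet> x)"
    by (fact dist_quat_def sgn_quat_def norm_quat_def)+
  show "(uniformity :: (quat \<times> quat) filter) = (INF e\<in>{0 <..}. principal {(x, y). dist x y < e})"
    by (fact uniformity_quat_def)
  show "open U \<longleftrightarrow> (\<forall>x\<in>U. eventually (\<lambda>(x', y). x' = x \<longrightarrow> y \<in> U) uniformity)" for U :: "quat set"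
    by (fact open_quat_def)
  show "x \<bullet> y = y \<bullet> x" "(x + y) \<bullet> z = x \<bullet> z + y \<bullet> z" "(r *\<^sub>R x) \<bullet> y = r * (x \<bullet> y)"
    by (simp_all add: inner_quat_def plus_quat_def scaleR_quat_def algebra_simps)
  show "0 \<le> x \<bullet> x" by (simp add: inner_quat_def)
  show "x \<bullet> x = 0 \<longleftrightarrow> x = 0"
    unfolding inner_quat_def zero_quat_def quat_eq_iff by (simp add: add_nonneg_eq_0_iff)
qed

end

instantiation quat :: euclidean_space
begin

definition Basis_quat_def: "Basis = {Quat 1 0 0 0, Quat 0 1 0 0, Quat 0 0 1 0, Quat 0 0 0 1}"

instance
proof
  fix u v x :: quat
  show "(Basis :: quat set) \<noteq> {}" "finite (Basis :: quat set)"
    by (simp_all add: Basis_quat_def)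
  show "u \<bullet> v = (if u = v then 1 else 0)" if "u \<in> Basis" "v \<in> Basis"
    using that unfolding Basis_quat_def by (elim insertE emptyE) (simp_all add: inner_quat_def)
  show "(\<forall>u\<in>Basis. x \<bullet> u = 0) \<longleftrightarrow> x = 0"
    by (simp add: Basis_quat_def inner_quat_def) (simp add: quat_eq_iff zero_quat_def)
qed

end

definition qcnj :: "quat \<Rightarrow> quat"
  where "qcnj x = Quat (qRe x) (- qI x) (- qJ x) (- qK x)"


section \<open>The classical matrix Lie algebras\<close>

text \<open>
  A matrix over the reals, complex numbers or quaternions acts on column vectors from the left;
  the result is regarded as an endomorphism of the underlying real vector space, whose
  inner product is the real part of the standard Hermitian form.
\<close>

definition mat_op :: "('k::{real_algebra_1,euclidean_space})^'n^'n \<Rightarrow> (('k^'n) \<Rightarrow>\<^sub>L ('k^'n))"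
  where "mat_op A = Blinfun (\<lambda>x. A *v x)"

lemma mat_op_apply: "blinfun_apply (mat_op A) x = A *v x"
proof -
  have "linear (\<lambda>x. A *v x)"
    by (rule linearI)
      (simp_all add: matrix_vector_mult_def vec_eq_iff sum.distrib distrib_left scaleR_right.sum)
  then show ?thesis
    by (simp add: mat_op_def bounded_linear_Blinfun_apply linear_conv_bounded_linear)
qed

definition so_alg :: "((real^'n) \<Rightarrow>\<^sub>L (real^'n)) set"
  where "so_alg = mat_op ` {A. transpose A = - A}"

definition su_alg :: "((complex^'n) \<Rightarrow>\<^sub>L (complex^'n)) set"
  where "su_alg = mat_op ` {A. (\<chi> i j. cnj (A $ j $ i)) = - A \<and> trace A = 0}"

definition sp_alg :: "((quat^'n) \<Rightarrow>\<^sub>L (quat^'n)) set"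
  where "sp_alg = mat_op ` {A. (\<chi> i j. qcnj (A $ j $ i)) = - A}"

end

theory Submission
  imports Defs
begin

text \<open>
  The coefficients \<open>c i j k = \<langle>[\<eta> i, \<eta> j], \<eta> k\<rangle>\<close> are totally antisymmetric, so
  \<open>w i j k = (c i j k)\<^sup>2\<close> is symmetric. As \<open>(\<eta> i \<cdot> T) (\<eta> j)\<close> has \<open>\<eta> k\<close>-coefficient
  \<open>(\<mu> j - \<mu> k) * c i j k\<close>, the squared norm of \<open>\<eta> i \<cdot> T\<close> is the sum of
  \<open>w i j k * (\<mu> j - \<mu> k)\<^sup>2\<close> over \<open>j\<close> and \<open>k\<close>. The estimate thus concerns a weighted graph on the
  eigenvalues for each \<open>i \<le> l\<close>, and the Lie algebra enters only through a bound on how much weight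
  few vertices can carry.

  That bound comes from the roots of \<open>so(V)\<close>. If a unit \<open>L\<close> has eigenvalues \<open>\<plusminus> a p * \<i>\<close>, then
  \<open>- (ad L)\<^sup>2\<close> has, besides 0, the double eigenvalues \<open>(a p + a q)\<^sup>2\<close> and \<open>(a p - a q)\<^sup>2\<close> for \<open>p < q\<close>
  (a kernel vector left over in odd dimension counts as half a plane with \<open>a q = 0\<close>). The vectors
  \<open>e p + e q\<close> and \<open>e p - e q\<close> have squared length 2 and mutual inner products at most 1 in absolute
  value, so the row sums of a Gram matrix of \<open>d\<close> of them are at most \<open>d + 1\<close>. Counting
  multiplicities, \<open>d\<close> orthonormal elements \<open>Z\<close> satisfy \<open>\<Sum> \<bar>[L, Z]\<bar>\<^sup>2 \<le> d + 2\<close>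
  (\<open>bracket_energy_orthonormal\<close>). Applied to an orthonormal basis of \<open>U + [L, U]\<close>, this says that the
  pairs of eigenvectors that meet a set of \<open>m\<close> eigenvectors have total weight at most \<open>m + 1\<close>
  (\<open>bracket_energy_touching\<close>).

  What remains is the combinatorial inequality \<open>weighted_gap_sum_le\<close>. For \<open>\<mu> j \<le> \<mu> k\<close> the gap
  \<open>(\<mu> j - \<mu> k)\<^sup>2\<close> is at most three times \<open>(\<mu> j)\<^sup>2\<close> if \<open>\<mu> j < 0\<close>, plus three halves of \<open>(\<mu> k)\<^sup>2\<close> if
  \<open>\<mu> k \<ge> 0\<close>. The nonnegative eigenvalues are never charged more than \<open>6 * l\<close>, since
  \<open>\<bar>[X, Y]\<bar>\<^sup>2 \<le> 2\<close> for orthonormal \<open>X\<close> and \<open>Y\<close>. An individual negative eigenvalue may be charged more, but the charges of the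
  \<open>m\<close> lowest ones add up to at most \<open>6 * l * m\<close>: the vertex \<open>i\<close> is isolated in its own graph, which
  compensates for the extra 1 in \<open>m + 1\<close>. Because the squares of the negative eigenvalues decrease,
  summation by parts turns these bounds on partial sums into the desired inequality.
\<close>

section \<open>The inner product of endomorphisms\<close>

text \<open>
  On skew endomorphisms this agrees with \<^const>\<open>lie_inner\<close>. Half the Hilbert-Schmidt product has
  the advantage of being symmetric and positive definite on all endomorphisms.
\<close>

definition endo_inner :: "('v::euclidean_space \<Rightarrow>\<^sub>L 'v) \<Rightarrow> ('v \<Rightarrow>\<^sub>L 'v) \<Rightarrow> real"
  where "endo_inner X Y = (\<Sum>b\<in>Basis. X b \<bullet> Y b) / 2"

lemma endo_inner_commute: "endo_inner X Y = endo_inner Y X"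
  by (simp add: endo_inner_def inner_commute)

lemma linear_endo_inner_left: "linear (\<lambda>X. endo_inner X Y)"
  by (rule linearI)
    (simp_all add: endo_inner_def blinfun.add_left blinfun.scaleR_left inner_add_left
      sum.distrib add_divide_distrib sum_distrib_left)

lemma linear_endo_inner_right: "linear (\<lambda>X. endo_inner Y X)"
  using linear_endo_inner_left[of Y] by (simp add: endo_inner_commute)

lemmas endo_inner_simps =
  linear_add[OF linear_endo_inner_left] linear_add[OF linear_endo_inner_right]
  linear_diff[OF linear_endo_inner_left] linear_diff[OF linear_endo_inner_right]
  linear_neg[OF linear_endo_inner_left] linear_neg[OF linear_endo_inner_right]
  linear_0[OF linear_endo_inner_left] linear_0[OF linear_endo_inner_right]
  linear_scale[OF linear_endo_inner_left, simplified] linear_scale[OF linear_endo_inner_right, simplified]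

lemmas endo_inner_sum =
  linear_sum[OF linear_endo_inner_left] linear_sum[OF linear_endo_inner_right]

lemma endo_inner_self_nonneg: "0 \<le> endo_inner X X"
  by (simp add: endo_inner_def sum_nonneg)

lemma endo_inner_self_eq_0_iff: "endo_inner X X = 0 \<longleftrightarrow> X = 0"
proof
  assume "endo_inner X X = 0"
  then have "\<forall>b\<in>Basis. X b \<bullet> X b = 0"
    by (simp add: endo_inner_def sum_nonneg_eq_0_iff)
  then show "X = 0" by (intro blinfun_euclidean_eqI) auto
qed (simp add: endo_inner_simps)

definition orthonormal_endos :: "'i set \<Rightarrow> ('i \<Rightarrow> ('v::euclidean_space \<Rightarrow>\<^sub>L 'v)) \<Rightarrow> bool"
  where "orthonormal_endos K Z \<longleftrightarrow>
    (\<forall>i\<in>K. \<forall>j\<in>K. endo_inner (Z i) (Z j) = (if i = j then 1 else 0))"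

lemma endo_bessel:
  assumes "finite K" "orthonormal_endos K Z"
  shows "(\<Sum>i\<in>K. (endo_inner (Z i) U)\<^sup>2) \<le> endo_inner U U"
proof -
  define R where "R = U - (\<Sum>i\<in>K. endo_inner (Z i) U *\<^sub>R Z i)"
  have ZR: "endo_inner (Z j) R = 0" if "j \<in> K" for j
  proof -
    have "endo_inner (Z j) (\<Sum>i\<in>K. endo_inner (Z i) U *\<^sub>R Z i)
        = (\<Sum>i\<in>K. endo_inner (Z i) U * endo_inner (Z j) (Z i))"
      by (simp add: endo_inner_sum endo_inner_simps)
    also have "\<dots> = (\<Sum>i\<in>K. if i = j then endo_inner (Z j) U else 0)"
      using assms that by (intro sum.cong) (auto simp: orthonormal_endos_def)
    also have "\<dots> = endo_inner (Z j) U" using assms(1) that by simp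
    finally show ?thesis by (simp add: R_def endo_inner_simps)
  qed
  have "0 \<le> endo_inner R R" by (rule endo_inner_self_nonneg)
  also have "\<dots> = endo_inner U R - (\<Sum>i\<in>K. endo_inner (Z i) U * endo_inner (Z i) R)"
    by (subst (1) R_def) (simp add: endo_inner_sum endo_inner_simps)
  also have "\<dots> = endo_inner U R" using ZR by simp
  also have "\<dots> = endo_inner U U - (\<Sum>i\<in>K. (endo_inner (Z i) U)\<^sup>2)"
    by (simp add: R_def endo_inner_sum endo_inner_simps power2_eq_square endo_inner_commute[of U "Z _"])
  finally show ?thesis by simp
qed

section \<open>Normal form of a skew endomorphism\<close>

lemma skewD: "L \<in> skew_endos \<Longrightarrow> L x \<bullet> y = - (x \<bullet> L y)"
  by (auto simp: skew_endos_def)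

text \<open>
  Normal form of a skew endomorphism, by splitting off one invariant plane after another. A vector
  \<open>v\<close> that maximizes \<open>norm (L v)\<close> on the unit sphere satisfies \<open>L (L v) = - (norm (L v))\<^sup>2 v\<close>, so
  \<open>v\<close> and \<open>L v\<close> span an invariant subspace. If \<open>L v = 0\<close>, the vector \<open>v\<close> is paired with \<open>f p = 0\<close>;
  this padding lets vectors of the kernel be treated as planes with \<open>a p = 0\<close>, at the price that
  the \<open>f p\<close> may vanish.
\<close>

lemma skew_invariant_subspace_frame:
  fixes L :: "'v::euclidean_space \<Rightarrow>\<^sub>L 'v"
  assumes skew: "L \<in> skew_endos" and "subspace S" and "\<forall>x\<in>S. L x \<in> S"
  shows "\<exists>(P::nat) e f (a :: nat \<Rightarrow> real).
    (\<forall>p<P. e p \<in> S \<and> f p \<in> S \<and> e p \<bullet> e p = 1 \<and> f p \<bullet> f p \<le> 1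
        \<and> L (e p) = a p *\<^sub>R f p \<and> L (f p) = - a p *\<^sub>R e p) \<and>
    (\<forall>p<P. \<forall>q<P. e p \<bullet> f q = 0 \<and> (p \<noteq> q \<longrightarrow> e p \<bullet> e q = 0 \<and> f p \<bullet> f q = 0)) \<and>
    (\<forall>x\<in>S. x = (\<Sum>p<P. (x \<bullet> e p) *\<^sub>R e p + (x \<bullet> f p) *\<^sub>R f p))"
  using assms(2,3)
proof (induction "dim S" arbitrary: S rule: less_induct)
  case less
  have skewD: "L x \<bullet> y = - (x \<bullet> L y)" for x y using skew by (auto simp: skew_endos_def)
  show ?case
  proof (cases "S \<subseteq> {0}")
    case True
    then show ?thesis
      by (intro exI[of _ 0]) auto
  next
    case False
    then obtain x0 where x0: "x0 \<in> S" "x0 \<noteq> 0" by auto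
    let ?K = "S \<inter> sphere 0 1"
    have "compact ?K" using less.prems(1) by (simp add: closed_Int_compact closed_subspace)
    moreover have "x0 /\<^sub>R norm x0 \<in> ?K" using x0 less.prems(1) by (simp add: subspace_scale)
    moreover have "continuous_on ?K (\<lambda>x. norm (L x))" by (intro continuous_intros)
    ultimately obtain v where v: "v \<in> ?K" and vmax: "\<And>x. x \<in> ?K \<Longrightarrow> norm (L x) \<le> norm (L v)"
      using continuous_attains_sup[of ?K "\<lambda>x. norm (L x)"] by (metis empty_iff)
    define s where "s = norm (L v)"
    define w where "w = L v /\<^sub>R s"
    have vS: "v \<in> S" and vv: "v \<bullet> v = 1" using v by (auto simp: dot_square_norm)
    have wS: "w \<in> S" unfolding w_def using less.prems vS by (simp add: subspace_scale)
    have Lv: "L v = s *\<^sub>R w" by (cases "s = 0") (auto simp: w_def s_def)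
    have bound: "L x \<bullet> L x \<le> s\<^sup>2 * (x \<bullet> x)" if "x \<in> S" for x
    proof (cases "x = 0")
      case False
      then have "x /\<^sub>R norm x \<in> ?K" using that less.prems(1) by (simp add: subspace_scale)
      from vmax[OF this] have "norm (L x) \<le> s * norm x"
        using False by (simp add: s_def blinfun.scaleR_right field_simps)
      then have "(norm (L x))\<^sup>2 \<le> (s * norm x)\<^sup>2" by (intro power_mono) auto
      then show ?thesis by (simp add: dot_square_norm power_mult_distrib)
    qed simp
    define z where "z = L (L v) + s\<^sup>2 *\<^sub>R v"
    have zS: "z \<in> S" unfolding z_def using less.prems vS
      by (simp add: subspace_add subspace_scale)
    \<comment> \<open>The form \<open>s\<^sup>2 * (x \<bullet> y) - L x \<bullet> L y\<close> is positive semidefinite on \<open>S\<close> and vanishes at \<open>v\<close>, so \<open>v\<close> lies in its radical.\<close>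
    have z0: "z = 0"
    proof -
      define \<gamma> where "\<gamma> = s\<^sup>2 * (z \<bullet> z) - L z \<bullet> L z"
      have \<gamma>0: "0 \<le> \<gamma>" using bound[OF zS] by (simp add: \<gamma>_def)
      have Lvv: "L v \<bullet> L v = s\<^sup>2" by (simp add: s_def dot_square_norm)
      have zz: "z \<bullet> z = s\<^sup>2 * (v \<bullet> z) - L v \<bullet> L z"
        using skewD[of "L v" z] by (simp add: z_def inner_add_left)
      have nonneg: "0 \<le> 2 * t * (z \<bullet> z) + t\<^sup>2 * \<gamma>" for t
      proof -
        have "v + t *\<^sub>R z \<in> S" using vS zS less.prems(1) by (simp add: subspace_add subspace_scale)
        note le = bound[OF this]
        have "s\<^sup>2 * ((v + t *\<^sub>R z) \<bullet> (v + t *\<^sub>R z)) - L (v + t *\<^sub>R z) \<bullet> L (v + t *\<^sub>R z)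
            = 2 * t * (s\<^sup>2 * (v \<bullet> z) - L v \<bullet> L z) + t\<^sup>2 * \<gamma>"
          unfolding \<gamma>_def
          by (simp add: blinfun.add_right blinfun.scaleR_right inner_add_left inner_add_right
              vv Lvv inner_commute algebra_simps power2_eq_square)
        then show ?thesis using le by (simp add: zz)
      qed
      define \<beta> where "\<beta> = z \<bullet> z"
      have "\<beta> = 0"
      proof (rule ccontr)
        assume "\<beta> \<noteq> 0"
        \<comment> \<open>A quadratic in \<open>t\<close> with nonzero linear term takes a negative value for a small \<open>t\<close>.\<close>
        define r where "r = 1 / (\<gamma> + 1)"
        have r: "0 < r" "r * \<gamma> \<le> 1" using \<gamma>0 by (auto simp: r_def)
        have "2 * (- \<beta> * r) * \<beta> + (- \<beta> * r)\<^sup>2 * \<gamma> = (\<beta>\<^sup>2 * r) * (r * \<gamma> - 2)"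
          by (simp add: algebra_simps power2_eq_square)
        also have "\<dots> < 0" using r \<open>\<beta> \<noteq> 0\<close> by (intro mult_pos_neg) auto
        finally show False using nonneg[of "- \<beta> * r"] by (simp add: \<beta>_def)
      qed
      then show ?thesis by (simp add: \<beta>_def)
    qed
    have Lw: "L w = - s *\<^sub>R v"
    proof (cases "s = 0")
      case False
      have "L (L v) = - (s\<^sup>2 *\<^sub>R v)" using z0 by (simp add: z_def eq_neg_iff_add_eq_0)
      then show ?thesis using False
        by (simp add: w_def blinfun.scaleR_right power2_eq_square)
    qed (simp add: w_def)
    have vw: "v \<bullet> w = 0" using skewD[of v v] by (simp add: w_def inner_commute)
    have ww: "w \<bullet> w \<le> 1"
      by (cases "norm (L v) = 0") (auto simp: w_def s_def dot_square_norm power2_eq_square)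
    have sw: "s * (w \<bullet> w) = s"
      by (cases "norm (L v) = 0") (auto simp add: w_def s_def dot_square_norm power2_eq_square)
    have wproj: "(x \<bullet> w) * (w \<bullet> w) = x \<bullet> w" for x
      by (cases "s = 0") (use sw in \<open>auto simp: w_def\<close>)
    define S' where "S' = S \<inter> {x. v \<bullet> x = 0} \<inter> {x. w \<bullet> x = 0}"
    have sub': "subspace S'" unfolding S'_def
      by (intro subspace_inter less.prems(1) subspace_hyperplane)
    have inv': "\<forall>x\<in>S'. L x \<in> S'"
    proof
      fix x assume "x \<in> S'"
      then show "L x \<in> S'"
        using less.prems(2) skewD[of v x] skewD[of w x] by (auto simp: S'_def Lv Lw)
    qed
    have "v \<notin> S'" using vv by (simp add: S'_def)
    then have "S' \<subset> S" using vS unfolding S'_def by blast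
    then have "dim S' < dim S"
      using sub' less.prems(1) by (intro dim_psubset) (simp add: span_eq_iff[THEN iffD2])
    from less.hyps[OF this sub' inv'] obtain P e f and a :: "nat \<Rightarrow> real" where I:
      "(\<forall>p<P. e p \<in> S' \<and> f p \<in> S' \<and> e p \<bullet> e p = 1 \<and> f p \<bullet> f p \<le> 1
        \<and> L (e p) = a p *\<^sub>R f p \<and> L (f p) = - a p *\<^sub>R e p) \<and>
       (\<forall>p<P. \<forall>q<P. e p \<bullet> f q = 0 \<and> (p \<noteq> q \<longrightarrow> e p \<bullet> e q = 0 \<and> f p \<bullet> f q = 0)) \<and>
       (\<forall>x\<in>S'. x = (\<Sum>p<P. (x \<bullet> e p) *\<^sub>R e p + (x \<bullet> f p) *\<^sub>R f p))"
      by (elim exE) (rule that)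
    note I1 = I[THEN conjunct1, rule_format]
      and I2 = I[THEN conjunct2, THEN conjunct1, rule_format]
      and I3 = I[THEN conjunct2, THEN conjunct2, rule_format]
    have orth: "v \<bullet> e p = 0" "v \<bullet> f p = 0" "w \<bullet> e p = 0" "w \<bullet> f p = 0"
      "e p \<bullet> v = 0" "f p \<bullet> v = 0" "e p \<bullet> w = 0" "f p \<bullet> w = 0" if "p < P" for p
      using I1[OF that] unfolding S'_def by (simp_all add: inner_commute)
    have res: "x = (\<Sum>p<Suc P. (x \<bullet> (e(P:=v)) p) *\<^sub>R (e(P:=v)) p + (x \<bullet> (f(P:=w)) p) *\<^sub>R (f(P:=w)) p)"
      if xS: "x \<in> S" for x
    proof -
      define y where "y = x - (x \<bullet> v) *\<^sub>R v - (x \<bullet> w) *\<^sub>R w"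
      have "y \<in> S" unfolding y_def using xS vS wS less.prems(1)
        by (intro subspace_diff subspace_scale)
      moreover have "v \<bullet> y = 0" by (simp add: y_def inner_diff_right vv vw inner_commute)
      moreover have "w \<bullet> y = w \<bullet> x - (x \<bullet> w) * (w \<bullet> w)"
        using vw by (simp add: y_def inner_diff_right inner_commute)
      then have "w \<bullet> y = 0" using wproj[of x] by (simp only: inner_commute[of w x])
      ultimately have "y \<in> S'" by (simp add: S'_def)
      from I3[OF this] have "y = (\<Sum>p<P. (y \<bullet> e p) *\<^sub>R e p + (y \<bullet> f p) *\<^sub>R f p)" .
      also have "\<dots> = (\<Sum>p<P. (x \<bullet> e p) *\<^sub>R e p + (x \<bullet> f p) *\<^sub>R f p)"
        by (rule sum.cong) (auto simp: y_def inner_diff_left orth)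
      finally have "x = (\<Sum>p<P. (x \<bullet> e p) *\<^sub>R e p + (x \<bullet> f p) *\<^sub>R f p) + ((x \<bullet> v) *\<^sub>R v + (x \<bullet> w) *\<^sub>R w)"
        by (simp add: y_def algebra_simps)
      then show ?thesis by simp
    qed
    let ?e = "e(P:=v)" and ?f = "f(P:=w)" and ?a = "a(P:=s)"
    have new1: "?e p \<in> S \<and> ?f p \<in> S \<and> ?e p \<bullet> ?e p = 1 \<and> ?f p \<bullet> ?f p \<le> 1
        \<and> L (?e p) = ?a p *\<^sub>R ?f p \<and> L (?f p) = - ?a p *\<^sub>R ?e p" if "p < Suc P" for p
    proof (cases "p = P")
      case True
      then show ?thesis using vS wS vv ww Lv Lw by simp
    next
      case False
      then have "p < P" using that by simp
      then show ?thesis using I1[of p] False unfolding S'_def by simp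
    qed
    have new2: "?e p \<bullet> ?f q = 0 \<and> (p \<noteq> q \<longrightarrow> ?e p \<bullet> ?e q = 0 \<and> ?f p \<bullet> ?f q = 0)"
      if "p < Suc P" "q < Suc P" for p q
    proof -
      have "p = P \<or> p < P" "q = P \<or> q < P" using that by auto
      then show ?thesis
        using I2[of p q] orth[of p] orth[of q] vw by (elim disjE) (simp_all add: inner_commute)
    qed
    have "\<forall>p<Suc P. ?e p \<in> S \<and> ?f p \<in> S \<and> ?e p \<bullet> ?e p = 1 \<and> ?f p \<bullet> ?f p \<le> 1
        \<and> L (?e p) = ?a p *\<^sub>R ?f p \<and> L (?f p) = - ?a p *\<^sub>R ?e p"
      using new1 by iprover
    moreover have "\<forall>p<Suc P. \<forall>q<Suc P.
        ?e p \<bullet> ?f q = 0 \<and> (p \<noteq> q \<longrightarrow> ?e p \<bullet> ?e q = 0 \<and> ?f p \<bullet> ?f q = 0)"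
      using new2 by iprover
    moreover have "\<forall>x\<in>S. x = (\<Sum>p<Suc P. (x \<bullet> ?e p) *\<^sub>R ?e p + (x \<bullet> ?f p) *\<^sub>R ?f p)"
      by (rule ballI) (rule res)
    ultimately show ?thesis by iprover
  qed
qed

lemma endo_inner_frame:
  assumes res: "\<And>x::'v::euclidean_space. x = (\<Sum>p<P. (x \<bullet> e p) *\<^sub>R e p + (x \<bullet> f p) *\<^sub>R f p)"
  shows "endo_inner X Y = (\<Sum>p<P. X (e p) \<bullet> Y (e p) + X (f p) \<bullet> Y (f p)) / 2"
proof -
  have rep: "(\<Sum>b\<in>Basis. (b \<bullet> u) * (z \<bullet> Y b)) = z \<bullet> Y u" for u z
  proof -
    have "z \<bullet> Y u = z \<bullet> Y (\<Sum>b\<in>Basis. (u \<bullet> b) *\<^sub>R b)" by (simp add: euclidean_representation)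
    also have "\<dots> = (\<Sum>b\<in>Basis. (b \<bullet> u) * (z \<bullet> Y b))"
      by (simp add: blinfun.sum_right blinfun.scaleR_right inner_sum_right inner_commute)
    finally show ?thesis by simp
  qed
  have X: "X b = (\<Sum>p<P. (b \<bullet> e p) *\<^sub>R X (e p) + (b \<bullet> f p) *\<^sub>R X (f p))" for b
    by (subst res[of b]) (simp add: blinfun.sum_right blinfun.add_right blinfun.scaleR_right)
  have "(\<Sum>b\<in>Basis. X b \<bullet> Y b)
      = (\<Sum>b\<in>Basis. \<Sum>p<P. (b \<bullet> e p) * (X (e p) \<bullet> Y b) + (b \<bullet> f p) * (X (f p) \<bullet> Y b))"
    by (rule sum.cong[OF refl], subst X) (simp add: inner_sum_left inner_add_left)
  also have "\<dots> = (\<Sum>p<P. X (e p) \<bullet> Y (e p) + X (f p) \<bullet> Y (f p))"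
    by (subst sum.swap) (simp add: sum.distrib rep)
  finally show ?thesis by (simp add: endo_inner_def)
qed

lemma inner_frame:
  assumes res: "\<And>x::'v::euclidean_space. x = (\<Sum>p<P. (x \<bullet> e p) *\<^sub>R e p + (x \<bullet> f p) *\<^sub>R f p)"
  shows "x \<bullet> x = (\<Sum>p<P. (x \<bullet> e p)\<^sup>2 + (x \<bullet> f p)\<^sup>2)"
proof -
  have "x \<bullet> x = x \<bullet> (\<Sum>p<P. (x \<bullet> e p) *\<^sub>R e p + (x \<bullet> f p) *\<^sub>R f p)" by (subst (2) res[of x]) simp
  then show ?thesis by (simp add: inner_sum_right inner_add_right power2_eq_square)
qed

text \<open>
  In block form with respect to the planes of the normal form, an endomorphism has blocks of size
  two by two; this is the squared Frobenius norm of one block.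
\<close>

definition plane_block_sq ::
    "(nat \<Rightarrow> 'v::euclidean_space) \<Rightarrow> (nat \<Rightarrow> 'v) \<Rightarrow> ('v \<Rightarrow>\<^sub>L 'v) \<Rightarrow> nat \<Rightarrow> nat \<Rightarrow> real"
  where "plane_block_sq e f X p q =
    (X (e p) \<bullet> e q)\<^sup>2 + (X (e p) \<bullet> f q)\<^sup>2 + ((X (f p) \<bullet> e q)\<^sup>2 + (X (f p) \<bullet> f q)\<^sup>2)"

lemma sum_symmetric_square:
  fixes h :: "nat \<Rightarrow> nat \<Rightarrow> real"
  assumes "\<And>p q. h p q = h q p"
  shows "(\<Sum>p<P. \<Sum>q<P. h p q) = 2 * (\<Sum>q<P. \<Sum>p<q. h p q) + (\<Sum>p<P. h p p)"
proof (induction P)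
  case (Suc P)
  have "(\<Sum>q<P. h P q) = (\<Sum>p<P. h p P)" using assms by simp
  then show ?case using Suc by (simp add: sum.distrib algebra_simps)
qed simp

lemma endo_inner_blocks:
  assumes res: "\<And>x::'v::euclidean_space. x = (\<Sum>p<P. (x \<bullet> e p) *\<^sub>R e p + (x \<bullet> f p) *\<^sub>R f p)"
    and X: "X \<in> skew_endos"
  shows "endo_inner X X = (\<Sum>q<P. \<Sum>p<q. plane_block_sq e f X p q) + (\<Sum>p<P. plane_block_sq e f X p p) / 2"
proof -
  have sym: "plane_block_sq e f X p q = plane_block_sq e f X q p" for p q
    using skewD[OF X, of "e p" "e q"] skewD[OF X, of "e p" "f q"]
      skewD[OF X, of "f p" "e q"] skewD[OF X, of "f p" "f q"]
    by (simp add: plane_block_sq_def inner_commute[of _ "X _"])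
  have "X (e p) \<bullet> X (e p) + X (f p) \<bullet> X (f p) = (\<Sum>q<P. plane_block_sq e f X p q)" for p
    by (simp only: inner_frame[OF res, of "X (e p)"] inner_frame[OF res, of "X (f p)"]
        plane_block_sq_def sum.distrib)
  then have "endo_inner X X = (\<Sum>p<P. \<Sum>q<P. plane_block_sq e f X p q) / 2"
    by (simp only: endo_inner_frame[OF res])
  then show ?thesis by (simp add: sum_symmetric_square[OF sym])
qed

section \<open>Brackets with orthonormal elements\<close>

text \<open>
  The bound for the roots. With \<open>g = \<Sum> m r * (c r \<bullet> a) * c r\<close>, the left-hand side is \<open>Q = g \<bullet> a\<close>,
  and Schur's test for the weighted Gram matrix, whose row sums are at most \<open>D + 2\<close>, gives
  \<open>g \<bullet> g \<le> (D + 2) * Q\<close>. The Cauchy-Schwarz inequality then bounds \<open>Q\<close>.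
\<close>

lemma weighted_gram_bound:
  fixes c :: "'r \<Rightarrow> 'k \<Rightarrow> real" and m :: "'r \<Rightarrow> real" and a :: "'k \<Rightarrow> real"
  assumes fin: "finite R" "finite K"
    and m0: "\<And>r. r \<in> R \<Longrightarrow> 0 \<le> m r" and m2: "\<And>r. r \<in> R \<Longrightarrow> m r \<le> 2"
    and total: "sum m R \<le> D"
    and diag: "\<And>r. r \<in> R \<Longrightarrow> (\<Sum>k\<in>K. (c r k)\<^sup>2) \<le> 2"
    and off: "\<And>r s. r \<in> R \<Longrightarrow> s \<in> R \<Longrightarrow> r \<noteq> s \<Longrightarrow> \<bar>\<Sum>k\<in>K. c r k * c s k\<bar> \<le> 1"
  shows "(\<Sum>r\<in>R. m r * (\<Sum>k\<in>K. c r k * a k)\<^sup>2) \<le> (D + 2) * (\<Sum>k\<in>K. (a k)\<^sup>2)"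
proof -
  define x where "x r = (\<Sum>k\<in>K. c r k * a k)" for r
  define G where "G r s = (\<Sum>k\<in>K. c r k * c s k)" for r s
  define Q where "Q = (\<Sum>r\<in>R. m r * (x r)\<^sup>2)"
  define g where "g k = (\<Sum>r\<in>R. m r * x r * c r k)" for k
  have Q0: "0 \<le> Q" unfolding Q_def by (intro sum_nonneg) (simp add: m0)
  have Qg: "Q = (\<Sum>k\<in>K. g k * a k)"
    unfolding Q_def g_def sum_distrib_right
    by (subst sum.swap) (simp add: x_def power2_eq_square sum_distrib_left mult_ac)
  have Gsym: "G r s = G s r" for r s by (simp add: G_def mult.commute)
  have rowsum: "(\<Sum>s\<in>R. m s * \<bar>G r s\<bar>) \<le> D + 2" if r: "r \<in> R" for r
  proof -
    have "m s * \<bar>G r s\<bar> \<le> m s + (if s = r then m r else 0)" if "s \<in> R" for s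
    proof (cases "s = r")
      case True
      have "\<bar>G r r\<bar> \<le> 2" using diag[OF r] by (simp add: G_def power2_eq_square sum_nonneg)
      then have "m r * \<bar>G r r\<bar> \<le> m r * 2" by (intro mult_left_mono m0 r)
      then show ?thesis using True by simp
    next
      case False
      then have "m s * \<bar>G r s\<bar> \<le> m s * 1"
        by (intro mult_left_mono m0 that) (use off[OF r that] in \<open>auto simp: G_def\<close>)
      then show ?thesis using False by simp
    qed
    then have "(\<Sum>s\<in>R. m s * \<bar>G r s\<bar>) \<le> (\<Sum>s\<in>R. m s + (if s = r then m r else 0))"
      by (rule sum_mono)
    also have "\<dots> = sum m R + m r" using fin r by (simp add: sum.distrib)
    finally show ?thesis using total m2[OF r] by linarith
  qed
  have gg: "(\<Sum>k\<in>K. (g k)\<^sup>2) \<le> (D + 2) * Q"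
  proof -
    have "(\<Sum>k\<in>K. (g k)\<^sup>2) = (\<Sum>k\<in>K. \<Sum>r\<in>R. \<Sum>s\<in>R. (m r * x r * c r k) * (m s * x s * c s k))"
      by (simp add: g_def power2_eq_square sum_product)
    also have "\<dots> = (\<Sum>r\<in>R. \<Sum>s\<in>R. \<Sum>k\<in>K. (m r * x r * c r k) * (m s * x s * c s k))"
      by (subst sum.swap, rule sum.cong[OF refl], rule sum.swap)
    also have "\<dots> = (\<Sum>r\<in>R. \<Sum>s\<in>R. m r * m s * (x r * x s * G r s))"
      by (simp add: G_def sum_distrib_left mult_ac)
    also have "\<dots> \<le> (\<Sum>r\<in>R. \<Sum>s\<in>R. m r * m s * (((x r)\<^sup>2 + (x s)\<^sup>2) / 2 * \<bar>G r s\<bar>))"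
    proof (intro sum_mono mult_left_mono mult_nonneg_nonneg m0)
      fix r s
      have "x r * x s * G r s \<le> \<bar>x r * x s\<bar> * \<bar>G r s\<bar>"
        by (metis abs_ge_self abs_mult)
      also have "\<bar>x r * x s\<bar> \<le> ((x r)\<^sup>2 + (x s)\<^sup>2) / 2"
      proof -
        have "0 \<le> (\<bar>x r\<bar> - \<bar>x s\<bar>)\<^sup>2" by simp
        then show ?thesis by (simp add: power2_diff abs_mult)
      qed
      finally show "x r * x s * G r s \<le> ((x r)\<^sup>2 + (x s)\<^sup>2) / 2 * \<bar>G r s\<bar>"
        by (simp add: mult_right_mono)
    qed
    also have "\<dots> = (\<Sum>r\<in>R. \<Sum>s\<in>R. m r * m s * (x r)\<^sup>2 * \<bar>G r s\<bar>) / 2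
                 + (\<Sum>r\<in>R. \<Sum>s\<in>R. m r * m s * (x s)\<^sup>2 * \<bar>G r s\<bar>) / 2"
      by (simp add: sum_divide_distrib sum.distrib[symmetric] field_simps)
    also have "(\<Sum>r\<in>R. \<Sum>s\<in>R. m r * m s * (x s)\<^sup>2 * \<bar>G r s\<bar>)
             = (\<Sum>r\<in>R. \<Sum>s\<in>R. m r * m s * (x r)\<^sup>2 * \<bar>G r s\<bar>)"
      by (subst sum.swap) (simp add: Gsym mult_ac)
    also have "(\<Sum>r\<in>R. \<Sum>s\<in>R. m r * m s * (x r)\<^sup>2 * \<bar>G r s\<bar>)
             = (\<Sum>r\<in>R. m r * (x r)\<^sup>2 * (\<Sum>s\<in>R. m s * \<bar>G r s\<bar>))"
      by (simp add: sum_distrib_left mult_ac)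
    finally have "(\<Sum>k\<in>K. (g k)\<^sup>2) \<le> (\<Sum>r\<in>R. m r * (x r)\<^sup>2 * (\<Sum>s\<in>R. m s * \<bar>G r s\<bar>))"
      by simp
    also have "\<dots> \<le> (\<Sum>r\<in>R. m r * (x r)\<^sup>2 * (D + 2))"
      by (intro sum_mono mult_left_mono rowsum mult_nonneg_nonneg m0) auto
    finally show ?thesis by (simp add: Q_def sum_distrib_left mult.commute)
  qed
  have D0: "0 \<le> D" using total sum_nonneg[of R m] m0 by force
  have "Q\<^sup>2 \<le> (\<Sum>k\<in>K. (g k)\<^sup>2) * (\<Sum>k\<in>K. (a k)\<^sup>2)"
    unfolding Qg by (rule Cauchy_Schwarz_ineq_sum)
  also have "\<dots> \<le> ((D + 2) * Q) * (\<Sum>k\<in>K. (a k)\<^sup>2)"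
    by (intro mult_right_mono gg sum_nonneg) auto
  finally have "Q * Q \<le> Q * ((D + 2) * (\<Sum>k\<in>K. (a k)\<^sup>2))"
    by (simp add: power2_eq_square mult_ac)
  then have "Q \<le> (D + 2) * (\<Sum>k\<in>K. (a k)\<^sup>2)"
    using Q0 D0 by (cases "Q = 0") (auto intro!: mult_nonneg_nonneg sum_nonneg)
  then show ?thesis by (simp add: Q_def x_def)
qed

lemma lie_bracket_apply: "lie_bracket L K x = L (K x) - K (L x)"
  by (simp add: lie_bracket_def blinfun.diff_left)

lemma lie_bracket_skew:
  assumes "L \<in> skew_endos" "K \<in> skew_endos" shows "lie_bracket L K \<in> skew_endos"
  using skewD[OF assms(1)] skewD[OF assms(2)]
  by (auto simp: skew_endos_def lie_bracket_apply inner_diff_left inner_diff_right)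

text \<open>
  The matrix entry \<open>X a \<bullet> b\<close> of a skew \<open>X\<close> is its inner product with the wedge product of \<open>a\<close> and \<open>b\<close>. This is what
  makes Bessel's inequality applicable to matrix entries.
\<close>

definition wedge :: "'v::euclidean_space \<Rightarrow> 'v \<Rightarrow> 'v \<Rightarrow>\<^sub>L 'v"
  where "wedge a b = Blinfun (\<lambda>v. (a \<bullet> v) *\<^sub>R b - (b \<bullet> v) *\<^sub>R a)"

lemma wedge_apply: "wedge a b v = (a \<bullet> v) *\<^sub>R b - (b \<bullet> v) *\<^sub>R a"
  unfolding wedge_def
  by (subst bounded_linear_Blinfun_apply) (intro bounded_linear_intros, simp)

lemma endo_inner_wedge:
  assumes "X \<in> skew_endos" shows "endo_inner X (wedge a b) = X a \<bullet> b"
proof -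
  have rep: "(\<Sum>c\<in>Basis. (u \<bullet> c) * (X c \<bullet> z)) = X u \<bullet> z" for u z
  proof -
    have "X u \<bullet> z = X (\<Sum>c\<in>Basis. (u \<bullet> c) *\<^sub>R c) \<bullet> z" by (simp add: euclidean_representation)
    also have "\<dots> = (\<Sum>c\<in>Basis. (u \<bullet> c) * (X c \<bullet> z))"
      by (simp add: blinfun.sum_right blinfun.scaleR_right inner_sum_left)
    finally show ?thesis by simp
  qed
  have "endo_inner X (wedge a b) = (X a \<bullet> b - X b \<bullet> a) / 2"
    by (simp add: endo_inner_def wedge_apply inner_diff_right sum_subtractf rep)
  then show ?thesis using skewD[OF assms, of b a] by (simp add: inner_commute)
qed

lemma wedge_skew: "wedge a b \<in> skew_endos"
  by (simp add: skew_endos_def wedge_apply inner_diff_left inner_diff_right inner_commute)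

text \<open>
  On the block of the planes \<open>p\<close> and \<open>q\<close>, the operator \<open>ad L\<close> acts as a rotation with speed
  \<open>a p + a q\<close> on one plane and \<open>a p - a q\<close> on another. The two summands for each sign \<open>s\<close> are the
  squared coordinates of \<open>Z\<close> in these root planes.
\<close>

lemma bracket_block:
  assumes L: "L \<in> skew_endos" and Z: "Z \<in> skew_endos"
    and ef: "L (e p) = a p *\<^sub>R f p" "L (f p) = - a p *\<^sub>R e p"
    "L (e q) = a q *\<^sub>R f q" "L (f q) = - a q *\<^sub>R e q"
  shows "plane_block_sq e f (lie_bracket L Z) p q =
     (\<Sum>s\<in>{1, -1}. (a p + s * a q)\<^sup>2 *
       (((Z (e p) \<bullet> e q - s * (Z (f p) \<bullet> f q))\<^sup>2 + (Z (e p) \<bullet> f q + s * (Z (f p) \<bullet> e q))\<^sup>2) / 2))"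
proof -
  have D: "lie_bracket L Z x \<bullet> y = - (Z x \<bullet> L y) - Z (L x) \<bullet> y" for x y
    using skewD[OF L] by (simp add: lie_bracket_apply inner_diff_left)
  show ?thesis
    unfolding plane_block_sq_def D ef
    by (simp add: blinfun.scaleR_right blinfun.minus_right power2_eq_square algebra_simps)
      (simp add: field_simps)
qed

text \<open>
  The index \<open>(q, p, s)\<close> stands for the root \<open>e p + s * e q\<close>, and \<open>\<mu> X\<close> measures the part of \<open>X\<close> in
  the corresponding root plane. Bessel's inequality, used once for each of two orthogonal directions,
  bounds the total mass of the \<open>Z i\<close> in a root plane by its dimension 2, and their mass over all
  root planes is at most the number of the \<open>Z i\<close>. These are the hypotheses of the bound for roots.
\<close>

lemma bracket_energy_orthonormal:
  fixes L :: "'v::euclidean_space \<Rightarrow>\<^sub>L 'v"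
  assumes L: "L \<in> skew_endos" and K: "finite K" and orth: "orthonormal_endos K Z"
    and Z: "\<And>i. i \<in> K \<Longrightarrow> Z i \<in> skew_endos"
  shows "(\<Sum>i\<in>K. endo_inner (lie_bracket L (Z i)) (lie_bracket L (Z i)))
       \<le> (real (card K) + 2) * endo_inner L L"
proof -
  obtain P :: nat and e f and a :: "nat \<Rightarrow> real" where N:
    "(\<forall>p<P. e p \<in> UNIV \<and> f p \<in> UNIV \<and> e p \<bullet> e p = 1 \<and> f p \<bullet> f p \<le> 1
        \<and> L (e p) = a p *\<^sub>R f p \<and> L (f p) = - a p *\<^sub>R e p) \<and>
    (\<forall>p<P. \<forall>q<P. e p \<bullet> f q = 0 \<and> (p \<noteq> q \<longrightarrow> e p \<bullet> e q = 0 \<and> f p \<bullet> f q = 0)) \<and>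
    (\<forall>x\<in>UNIV. x = (\<Sum>p<P. (x \<bullet> e p) *\<^sub>R e p + (x \<bullet> f p) *\<^sub>R f p))"
    using skew_invariant_subspace_frame[OF L subspace_UNIV ballI[OF UNIV_I]]
    by (elim exE) (rule that)
  note N1 = N[THEN conjunct1, rule_format] and N2 = N[THEN conjunct2, THEN conjunct1, rule_format]
    and res = N[THEN conjunct2, THEN conjunct2, rule_format, OF UNIV_I]
  define R where "R = (SIGMA q:{..<P}. {..<q} \<times> {1, - 1 :: real})"
  define \<mu> where "\<mu> = (\<lambda>(X :: 'v \<Rightarrow>\<^sub>L 'v) (q, p, s). ((X (e p) \<bullet> e q - s * (X (f p) \<bullet> f q))\<^sup>2
      + (X (e p) \<bullet> f q + s * (X (f p) \<bullet> e q))\<^sup>2) / 2)"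
  define c where "c = (\<lambda>(q :: nat, p, s) k. (if k = p then 1 else 0) + (if k = q then s else (0::real)))"
  have finR: "finite R" by (simp add: R_def)
  have sumR: "sum F R = (\<Sum>q<P. \<Sum>p<q. \<Sum>s\<in>{1, -1}. F (q, p, s))" for F :: "_ \<Rightarrow> real"
  proof -
    have "(\<Sum>q<P. \<Sum>p<q. \<Sum>s\<in>{1, -1}. F (q, p, s)) = (\<Sum>q<P. \<Sum>y\<in>{..<q} \<times> {1, -1}. F (q, y))"
      unfolding sum.cartesian_product by (simp only: split_def prod.collapse)
    also have "\<dots> = (\<Sum>(q, y)\<in>R. F (q, y))"
      unfolding R_def by (rule sum.Sigma) auto
    finally show ?thesis by simp
  qed
  have c_sum: "(\<Sum>k<P. c (q, p, s) k * h k) = h p + s * h q" if "p < q" "q < P" for q p s h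
  proof -
    have "(\<Sum>k<P. c (q, p, s) k * h k) = (\<Sum>k<P. (if k = p then h k else 0) + (if k = q then s * h k else 0))"
      using that by (intro sum.cong) (auto simp: c_def)
    then show ?thesis using that by (simp add: sum.distrib)
  qed
  have \<mu>0: "0 \<le> \<mu> X r" for X r by (cases r) (simp add: \<mu>_def)
  have energy: "endo_inner (lie_bracket L X) (lie_bracket L X)
      = (\<Sum>r\<in>R. \<mu> X r * (\<Sum>k<P. c r k * a k)\<^sup>2)" if X: "X \<in> skew_endos" for X
  proof -
    have "plane_block_sq e f (lie_bracket L X) p p = 0" if "p < P" for p
      using N1[OF that] skewD[OF X, of "e p" "e p"] skewD[OF X, of "f p" "f p"] skewD[OF X, of "f p" "e p"]
      by (subst bracket_block[OF L X, where a = a]) (simp_all add: inner_commute)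
    then have "endo_inner (lie_bracket L X) (lie_bracket L X)
        = (\<Sum>q<P. \<Sum>p<q. plane_block_sq e f (lie_bracket L X) p q)"
      by (simp add: endo_inner_blocks[OF res lie_bracket_skew[OF L X]])
    also have "\<dots> = (\<Sum>q<P. \<Sum>p<q. \<Sum>s\<in>{1, -1}. \<mu> X (q, p, s) * (\<Sum>k<P. c (q, p, s) k * a k)\<^sup>2)"
    proof (intro sum.cong refl)
      fix q p assume "q \<in> {..<P}" "p \<in> {..<q}"
      then have pq: "p < q" "q < P" and "p < P" by auto
      have "plane_block_sq e f (lie_bracket L X) p q = (\<Sum>s\<in>{1, -1}. (a p + s * a q)\<^sup>2 * \<mu> X (q, p, s))"
        unfolding \<mu>_def case_prod_conv
        by (rule bracket_block[OF L X]) (use N1[OF \<open>p < P\<close>] N1[OF \<open>q < P\<close>] in auto)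
      then show "plane_block_sq e f (lie_bracket L X) p q
          = (\<Sum>s\<in>{1, -1}. \<mu> X (q, p, s) * (\<Sum>k<P. c (q, p, s) k * a k)\<^sup>2)"
        by (simp only: c_sum[OF pq]) (simp only: mult.commute)
    qed
    finally show ?thesis by (simp only: sumR)
  qed
  have mass: "sum (\<mu> X) R \<le> endo_inner X X" if X: "X \<in> skew_endos" for X
  proof -
    have "sum (\<mu> X) R = (\<Sum>q<P. \<Sum>p<q. plane_block_sq e f X p q)"
      unfolding sumR by (intro sum.cong refl) (simp add: \<mu>_def plane_block_sq_def power2_eq_square field_simps)
    moreover have "0 \<le> (\<Sum>p<P. plane_block_sq e f X p p)"
      by (intro sum_nonneg) (simp add: plane_block_sq_def)
    ultimately show ?thesis by (simp add: endo_inner_blocks[OF res X])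
  qed
  have cap: "(\<Sum>i\<in>K. \<mu> (Z i) r) \<le> 2" if r: "r \<in> R" for r
  proof -
    obtain q p s where r_eq: "r = (q, p, s)" by (cases r)
    have pq: "p < q" "q < P" "p < P" and s: "s\<^sup>2 = 1" using r by (auto simp: r_eq R_def)
    define U V where "U = wedge (e p) (e q) - s *\<^sub>R wedge (f p) (f q)"
      and "V = wedge (e p) (f q) + s *\<^sub>R wedge (f p) (e q)"
    have sc: "(s * x)\<^sup>2 = x\<^sup>2" "s * (s * x) = x" for x
      using s by (simp_all add: power_mult_distrib mult.assoc[symmetric] power2_eq_square)
    have UV: "\<mu> X r = ((endo_inner X U)\<^sup>2 + (endo_inner X V)\<^sup>2) / 2" if "X \<in> skew_endos" for X
      using that by (simp add: \<mu>_def r_eq U_def V_def endo_inner_simps endo_inner_wedge)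
    have eq: "e p \<bullet> e p = 1" "e q \<bullet> e q = 1" "f p \<bullet> f p \<le> 1" "f q \<bullet> f q \<le> 1"
      and zero: "e p \<bullet> e q = 0" "e q \<bullet> e p = 0" "f p \<bullet> f q = 0" "f q \<bullet> f p = 0"
      "e p \<bullet> f q = 0" "e q \<bullet> f p = 0" "f p \<bullet> e q = 0" "f q \<bullet> e p = 0"
      "e p \<bullet> f p = 0" "e q \<bullet> f q = 0" "f p \<bullet> e p = 0" "f q \<bullet> e q = 0"
      using N1[of p] N1[of q] N2[of p q] N2[of q p] N2[of p p] N2[of q q] pq
      by (simp_all add: inner_commute)
    have ff: "(f p \<bullet> f p) * (f q \<bullet> f q) \<le> 1"
      using mult_mono[OF eq(3) eq(4)] by simp
    have "endo_inner U U \<le> 2"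
      using ff by (simp add: U_def endo_inner_simps endo_inner_wedge[OF wedge_skew] wedge_apply
          inner_diff_left zero eq(1,2) sc)
    moreover have "endo_inner V V \<le> 2"
      using eq(3,4) by (simp add: V_def endo_inner_simps endo_inner_wedge[OF wedge_skew] wedge_apply
          inner_diff_left zero eq(1,2) sc)
    moreover have "(\<Sum>i\<in>K. \<mu> (Z i) r) = ((\<Sum>i\<in>K. (endo_inner (Z i) U)\<^sup>2) + (\<Sum>i\<in>K. (endo_inner (Z i) V)\<^sup>2)) / 2"
      by (simp add: UV Z sum.distrib sum_divide_distrib[symmetric] cong: sum.cong)
    ultimately show ?thesis
      using endo_bessel[OF K orth, of U] endo_bessel[OF K orth, of V] by simp
  qed
  have La: "endo_inner L L = (\<Sum>p<P. (a p)\<^sup>2)"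
  proof -
    have "L (e p) \<bullet> L (e p) + L (f p) \<bullet> L (f p) = 2 * (a p)\<^sup>2" if "p < P" for p
    proof -
      \<comment> \<open>The vector \<open>f p\<close> has length 1 unless \<open>a p = 0\<close>, because \<open>L\<close> is skew.\<close>
      have "a p * (f p \<bullet> f p) = a p"
        using skewD[OF L, of "e p" "f p"] N1[OF that] by simp
      then show ?thesis using N1[OF that] by (simp add: power2_eq_square)
    qed
    then show ?thesis by (simp add: endo_inner_frame[OF res] sum_distrib_left[symmetric])
  qed
  have "(\<Sum>i\<in>K. endo_inner (lie_bracket L (Z i)) (lie_bracket L (Z i)))
      = (\<Sum>i\<in>K. \<Sum>r\<in>R. \<mu> (Z i) r * (\<Sum>k<P. c r k * a k)\<^sup>2)"
    using Z by (simp add: energy cong: sum.cong)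
  also have "\<dots> = (\<Sum>r\<in>R. (\<Sum>i\<in>K. \<mu> (Z i) r) * (\<Sum>k<P. c r k * a k)\<^sup>2)"
    by (subst sum.swap) (simp add: sum_distrib_right)
  also have "\<dots> \<le> (real (card K) + 2) * (\<Sum>p<P. (a p)\<^sup>2)"
  proof (rule weighted_gram_bound[OF finR finite_lessThan])
    show "0 \<le> (\<Sum>i\<in>K. \<mu> (Z i) r)" for r by (intro sum_nonneg \<mu>0)
    show "(\<Sum>i\<in>K. \<mu> (Z i) r) \<le> 2" if "r \<in> R" for r using that by (rule cap)
    have "(\<Sum>r\<in>R. \<Sum>i\<in>K. \<mu> (Z i) r) = (\<Sum>i\<in>K. sum (\<mu> (Z i)) R)" by (rule sum.swap)
    also have "\<dots> \<le> (\<Sum>i\<in>K. endo_inner (Z i) (Z i))" by (intro sum_mono mass Z)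
    also have "\<dots> = real (card K)" using orth by (simp add: orthonormal_endos_def)
    finally show "(\<Sum>r\<in>R. \<Sum>i\<in>K. \<mu> (Z i) r) \<le> real (card K)" .
    show "(\<Sum>k<P. (c r k)\<^sup>2) \<le> 2" if "r \<in> R" for r
    proof -
      obtain q p s where "r = (q, p, s)" by (cases r)
      with that show ?thesis
        by (auto simp: R_def power2_eq_square c_sum) (auto simp: c_def)
    qed
    show "\<bar>\<Sum>k<P. c r k * c r' k\<bar> \<le> 1" if "r \<in> R" "r' \<in> R" "r \<noteq> r'" for r r'
    proof -
      obtain q p s q' p' s' where "r = (q, p, s)" "r' = (q', p', s')" by (cases r, cases r')
      with that show ?thesis
        by (auto simp: R_def c_sum) (auto simp: c_def)
    qed
  qed
  finally show ?thesis by (simp add: La)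
qed

lemma subspace_skew_endos: "subspace skew_endos"
  by (auto simp: subspace_def skew_endos_def blinfun.add_left blinfun.scaleR_left
      inner_add_left inner_add_right)

lemma endo_inner_bracket_skew:
  assumes L: "L \<in> skew_endos"
  shows "endo_inner (lie_bracket L X) Y = - endo_inner X (lie_bracket L Y)"
proof -
  have "(\<Sum>b\<in>Basis. X (L b) \<bullet> Y b) = - (\<Sum>b\<in>Basis. X b \<bullet> Y (L b))"
  proof -
    have "X (L b) = (\<Sum>c\<in>Basis. (L b \<bullet> c) *\<^sub>R X c)" for b
      by (subst euclidean_representation[of "L b", symmetric])
        (simp add: blinfun.sum_right blinfun.scaleR_right)
    then have "(\<Sum>b\<in>Basis. X (L b) \<bullet> Y b) = (\<Sum>c\<in>Basis. \<Sum>b\<in>Basis. (L b \<bullet> c) * (X c \<bullet> Y b))"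
      by (subst sum.swap) (simp add: inner_sum_left)
    also have "\<dots> = (\<Sum>c\<in>Basis. - (X c \<bullet> Y (L c)))"
    proof (rule sum.cong[OF refl])
      fix c
      have "X c \<bullet> Y (L c) = X c \<bullet> Y (\<Sum>b\<in>Basis. (L c \<bullet> b) *\<^sub>R b)"
        by (simp add: euclidean_representation)
      also have "\<dots> = (\<Sum>b\<in>Basis. (L c \<bullet> b) * (X c \<bullet> Y b))"
        by (simp add: blinfun.sum_right blinfun.scaleR_right inner_sum_right)
      also have "\<dots> = - (\<Sum>b\<in>Basis. (L b \<bullet> c) * (X c \<bullet> Y b))"
        unfolding sum_negf[symmetric]
        by (rule sum.cong[OF refl]) (use skewD[OF L, of c] in \<open>simp add: inner_commute[of c]\<close>)
      finally show "(\<Sum>b\<in>Basis. (L b \<bullet> c) * (X c \<bullet> Y b)) = - (X c \<bullet> Y (L c))" by simp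
    qed
    finally show ?thesis by (simp add: sum_negf)
  qed
  moreover have "(\<Sum>b\<in>Basis. L (X b) \<bullet> Y b) = - (\<Sum>b\<in>Basis. X b \<bullet> L (Y b))"
    by (simp add: skewD[OF L, of "X _" "Y _"] sum_negf)
  ultimately show ?thesis
    by (simp add: endo_inner_def lie_bracket_apply inner_diff_left inner_diff_right sum_subtractf
        field_simps)
qed

text \<open>
  Gram-Schmidt orthogonalization. The condition on all subspaces \<open>S\<close> is a convenient way to say that
  the \<open>v k\<close> lie in the span of the \<open>w j\<close>: it transfers both skewness and orthogonality to given
  elements.
\<close>

lemma endo_gram_schmidt:
  assumes "finite J"
  shows "\<exists>(d::nat) v. d \<le> card J \<and> orthonormal_endos {..<d} v \<and>
    (\<forall>S. subspace S \<longrightarrow> w ` J \<subseteq> S \<longrightarrow> v ` {..<d} \<subseteq> S) \<and>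
    (\<forall>j\<in>J. w j = (\<Sum>k<d. endo_inner (w j) (v k) *\<^sub>R v k))"
  using assms
proof (induction J)
  case empty
  show ?case by (intro exI[of _ 0]) (auto simp: orthonormal_endos_def)
next
  case (insert i J)
  from insert.IH obtain d :: nat and v where H: "d \<le> card J \<and> orthonormal_endos {..<d} v \<and>
    (\<forall>S. subspace S \<longrightarrow> w ` J \<subseteq> S \<longrightarrow> v ` {..<d} \<subseteq> S) \<and>
    (\<forall>j\<in>J. w j = (\<Sum>k<d. endo_inner (w j) (v k) *\<^sub>R v k))"
    by (elim exE) (rule that)
  then have IH: "d \<le> card J" "orthonormal_endos {..<d} v"
    "\<And>S. subspace S \<Longrightarrow> w ` J \<subseteq> S \<Longrightarrow> v ` {..<d} \<subseteq> S"
    by iprover+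
  note IH4 = H[THEN conjunct2, THEN conjunct2, THEN conjunct2, THEN bspec]
  have on: "endo_inner (v k) (v k') = (if k = k' then 1 else 0)" if "k < d" "k' < d" for k k'
    using IH(2) that by (simp add: orthonormal_endos_def)
  define R where "R = w i - (\<Sum>k<d. endo_inner (w i) (v k) *\<^sub>R v k)"
  have vR: "endo_inner (v k) R = 0" if "k < d" for k
  proof -
    have "endo_inner (v k) (\<Sum>k<d. endo_inner (w i) (v k) *\<^sub>R v k)
        = (\<Sum>k'<d. if k' = k then endo_inner (w i) (v k) else 0)"
      unfolding endo_inner_sum using that by (intro sum.cong) (auto simp: endo_inner_simps on)
    also have "\<dots> = endo_inner (v k) (w i)" using that by (simp add: endo_inner_commute)
    finally show ?thesis by (simp add: R_def endo_inner_simps)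
  qed
  have span: "R \<in> S" if "subspace S" "w ` insert i J \<subseteq> S" for S
    unfolding R_def using IH(3)[of S] that
    by (intro subspace_diff subspace_sum subspace_scale) auto
  show ?case
  proof (cases "R = 0")
    case True
    then have "w i = (\<Sum>k<d. endo_inner (w i) (v k) *\<^sub>R v k)" by (simp add: R_def)
    moreover have "d \<le> card (insert i J)" using IH(1) insert.hyps by simp
    moreover have "v ` {..<d} \<subseteq> S" if "subspace S" "w ` insert i J \<subseteq> S" for S
      using IH(3)[of S] that by simp
    ultimately show ?thesis using IH(2) IH4 by (intro exI[of _ d] exI[of _ v]) blast
  next
    case False
    define n where "n = sqrt (endo_inner R R)"
    have n: "0 < n" "n * n = endo_inner R R"
      using False endo_inner_self_nonneg[of R] endo_inner_self_eq_0_iff[of R]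
      by (auto simp: n_def less_le)
    define v' where "v' = v(d := R /\<^sub>R n)"
    have v': "v' k = v k" if "k < d" for k using that by (simp add: v'_def)
    have v'd: "v' d = R /\<^sub>R n" by (simp add: v'_def)
    have "orthonormal_endos {..<Suc d} v'"
      unfolding orthonormal_endos_def
    proof (intro ballI)
      fix k k' assume "k \<in> {..<Suc d}" "k' \<in> {..<Suc d}"
      then have "k < d \<or> k = d" "k' < d \<or> k' = d" by auto
      then show "endo_inner (v' k) (v' k') = (if k = k' then 1 else 0)"
        using n by (elim disjE) (auto simp: v' v'd on vR endo_inner_simps
            endo_inner_commute[of R "v _"] field_simps)
    qed
    moreover have "v' ` {..<Suc d} \<subseteq> S" if "subspace S" "w ` insert i J \<subseteq> S" for S
      using IH(3)[of S] span[of S] that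
      by (auto simp: lessThan_Suc v' v'd subspace_scale)
    moreover have "w j = (\<Sum>k<Suc d. endo_inner (w j) (v' k) *\<^sub>R v' k)" if "j \<in> insert i J" for j
    proof (cases "j = i")
      case True
      have "endo_inner (w i) R = endo_inner R R"
      proof -
        have "endo_inner R R = endo_inner (w i) R - (\<Sum>k<d. endo_inner (w i) (v k) * endo_inner (v k) R)"
          by (subst (1) R_def) (simp add: endo_inner_simps endo_inner_sum)
        then show ?thesis by (simp add: vR)
      qed
      then have "endo_inner (w i) (v' d) *\<^sub>R v' d = R"
        using n(1) by (simp add: v'd endo_inner_simps field_simps flip: n(2))
      then show ?thesis using True by (simp add: v' R_def)
    next
      case False
      then have j: "j \<in> J" using that by simp
      have "endo_inner (w j) R = 0"
        by (subst IH4[OF j]) (simp add: endo_inner_sum endo_inner_simps vR)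
      then have "endo_inner (w j) (v' d) = 0" by (simp add: v'd endo_inner_simps)
      then have "(\<Sum>k<Suc d. endo_inner (w j) (v' k) *\<^sub>R v' k) = (\<Sum>k<d. endo_inner (w j) (v k) *\<^sub>R v k)"
        by (simp add: v')
      then show ?thesis by (rule trans[OF IH4[OF j] sym])
    qed
    moreover have "Suc d \<le> card (insert i J)" using IH(1) insert.hyps by simp
    ultimately show ?thesis by (intro exI[of _ "Suc d"] exI[of _ v']) blast
  qed
qed

text \<open>
  Let \<open>U\<close> be the span of the \<open>X j\<close> and let \<open>v\<close> be an orthonormal basis of the span of the components
  \<open>w j\<close> of \<open>[L, X j]\<close> orthogonal to \<open>U\<close>. There are at most \<open>2 * card J\<close> vectors in \<open>X\<close> and \<open>v\<close>
  together, so the squared lengths of their brackets with \<open>L\<close> add up to at most \<open>2 * card J + 2\<close>. As \<open>ad L\<close>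
  is skew, the components of the \<open>[L, v k]\<close> in \<open>U\<close> already have the same total squared length as the
  \<open>w j\<close>, and the \<open>[L, X j]\<close> consist of the \<open>w j\<close> and of components in \<open>U\<close>. Halving gives the claim.

  In an orthonormal basis that contains the \<open>X j\<close>, the left-hand side is the total squared coefficient
  of \<open>ad L\<close> over all pairs that meet \<open>J\<close>, each pair counted once.
\<close>

lemma bracket_energy_touching:
  assumes L: "L \<in> skew_endos" "endo_inner L L = 1"
    and J: "finite J" and orth: "orthonormal_endos J X"
    and X: "\<And>j. j \<in> J \<Longrightarrow> X j \<in> skew_endos"
  shows "(\<Sum>j\<in>J. endo_inner (lie_bracket L (X j)) (lie_bracket L (X j)))
       - (\<Sum>j\<in>J. \<Sum>k\<in>J. (endo_inner (lie_bracket L (X j)) (X k))\<^sup>2) / 2 \<le> real (card J) + 1"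
proof -
  define A where "A = lie_bracket L"
  define w where "w j = A (X j) - (\<Sum>k\<in>J. endo_inner (A (X j)) (X k) *\<^sub>R X k)" for j
  have on: "endo_inner (X j) (X k) = (if j = k then 1 else 0)" if "j \<in> J" "k \<in> J" for j k
    using orth that by (simp add: orthonormal_endos_def)
  have Xw: "endo_inner (X k) (w j) = 0" if "k \<in> J" for j k
  proof -
    have "endo_inner (X k) (\<Sum>k\<in>J. endo_inner (A (X j)) (X k) *\<^sub>R X k)
        = (\<Sum>k'\<in>J. if k' = k then endo_inner (A (X j)) (X k) else 0)"
      unfolding endo_inner_sum using that by (intro sum.cong) (auto simp: endo_inner_simps on)
    also have "\<dots> = endo_inner (X k) (A (X j))" using that J by (simp add: endo_inner_commute)
    finally show ?thesis by (simp add: w_def endo_inner_simps)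
  qed
  have ww: "endo_inner (w j) (w j) = endo_inner (A (X j)) (A (X j)) - (\<Sum>k\<in>J. (endo_inner (A (X j)) (X k))\<^sup>2)" for j
  proof -
    have "endo_inner (w j) (w j) = endo_inner (A (X j)) (w j) - (\<Sum>k\<in>J. endo_inner (A (X j)) (X k) * endo_inner (X k) (w j))"
      by (subst (1) w_def) (simp add: endo_inner_simps endo_inner_sum)
    also have "\<dots> = endo_inner (A (X j)) (w j)" by (simp add: Xw)
    also have "\<dots> = endo_inner (A (X j)) (A (X j)) - (\<Sum>k\<in>J. (endo_inner (A (X j)) (X k))\<^sup>2)"
      by (simp add: w_def endo_inner_simps endo_inner_sum power2_eq_square)
    finally show ?thesis .
  qed
  from endo_gram_schmidt[OF J, of w] obtain d :: nat and v where H: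
    "d \<le> card J \<and> orthonormal_endos {..<d} v \<and>
    (\<forall>S. subspace S \<longrightarrow> w ` J \<subseteq> S \<longrightarrow> v ` {..<d} \<subseteq> S) \<and>
    (\<forall>j\<in>J. w j = (\<Sum>k<d. endo_inner (w j) (v k) *\<^sub>R v k))"
    by (elim exE) (rule that)
  then have d: "d \<le> card J" and von: "orthonormal_endos {..<d} v"
    and vS: "\<And>S. subspace S \<Longrightarrow> w ` J \<subseteq> S \<Longrightarrow> v ` {..<d} \<subseteq> S"
    by iprover+
  note wv = H[THEN conjunct2, THEN conjunct2, THEN conjunct2, THEN bspec]
  have Ask: "A Y \<in> skew_endos" if "Y \<in> skew_endos" for Y
    unfolding A_def using L(1) that by (rule lie_bracket_skew)
  have "w ` J \<subseteq> skew_endos"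
    unfolding w_def using Ask X
    by (auto intro!: subspace_diff subspace_sum subspace_scale subspace_skew_endos)
  then have vsk: "v k \<in> skew_endos" if "k < d" for k
    using vS[OF subspace_skew_endos] that by auto
  have Xv: "endo_inner (X j) (v k) = 0" if "j \<in> J" "k < d" for j k
  proof -
    have "subspace {Y. endo_inner (X j) Y = 0}"
      by (auto simp: subspace_def endo_inner_simps)
    from vS[OF this] show ?thesis using that Xw by auto
  qed
  have on_v: "endo_inner (v j) (v k) = (if j = k then 1 else 0)" if "j < d" "k < d" for j k
    using von that by (simp add: orthonormal_endos_def)
  define Z where "Z = case_sum X v"
  have "orthonormal_endos (J <+> {..<d}) Z"
    by (auto simp: orthonormal_endos_def Z_def on on_v Xv endo_inner_commute[of "v _" "X _"] split: if_splits)
  moreover have "Z i \<in> skew_endos" if "i \<in> J <+> {..<d}" for i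
    using that X vsk by (auto simp: Z_def)
  ultimately have "(\<Sum>i\<in>J <+> {..<d}. endo_inner (A (Z i)) (A (Z i)))
      \<le> (real (card (J <+> {..<d})) + 2) * endo_inner L L"
    unfolding A_def using J by (intro bracket_energy_orthonormal L(1)) auto
  then have total: "(\<Sum>j\<in>J. endo_inner (A (X j)) (A (X j))) + (\<Sum>k<d. endo_inner (A (v k)) (A (v k)))
      \<le> 2 * real (card J) + 2"
    using J d L(2) by (simp add: sum.Plus card_Plus Z_def)
  have "(\<Sum>j\<in>J. endo_inner (w j) (w j)) = (\<Sum>j\<in>J. \<Sum>k<d. (endo_inner (X j) (A (v k)))\<^sup>2)"
  proof (rule sum.cong[OF refl])
    fix j assume j: "j \<in> J"
    have "endo_inner (w j) (w j) = endo_inner (w j) (\<Sum>k<d. endo_inner (w j) (v k) *\<^sub>R v k)"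
      using wv[OF j] by (rule arg_cong)
    also have "\<dots> = (\<Sum>k<d. (endo_inner (w j) (v k))\<^sup>2)"
      by (simp add: endo_inner_simps endo_inner_sum power2_eq_square)
    also have "\<dots> = (\<Sum>k<d. (endo_inner (A (X j)) (v k))\<^sup>2)"
    proof (rule sum.cong[OF refl])
      fix k assume "k \<in> {..<d}"
      then have "(\<Sum>i\<in>J. endo_inner (A (X j)) (X i) * endo_inner (X i) (v k)) = 0"
        by (intro sum.neutral) (simp add: Xv)
      then show "(endo_inner (w j) (v k))\<^sup>2 = (endo_inner (A (X j)) (v k))\<^sup>2"
        by (simp add: w_def endo_inner_simps endo_inner_sum)
    qed
    also have "\<dots> = (\<Sum>k<d. (endo_inner (X j) (A (v k)))\<^sup>2)"
      by (simp add: A_def endo_inner_bracket_skew[OF L(1), of "X j"])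
    finally show "endo_inner (w j) (w j) = (\<Sum>k<d. (endo_inner (X j) (A (v k)))\<^sup>2)" .
  qed
  also have "\<dots> = (\<Sum>k<d. \<Sum>j\<in>J. (endo_inner (X j) (A (v k)))\<^sup>2)" by (rule sum.swap)
  also have "\<dots> \<le> (\<Sum>k<d. endo_inner (A (v k)) (A (v k)))"
    by (intro sum_mono endo_bessel J orth)
  finally show ?thesis using total
    by (simp add: ww sum_subtractf A_def)
qed

section \<open>Weighted sums of gaps between ordered numbers\<close>

text \<open>
  Summation by parts: in terms of the partial sums of \<open>y\<close>, the sum has the nonnegative coefficients
  \<open>x m - x (Suc m)\<close> and \<open>x N\<close>.
\<close>

lemma sum_mult_antitone_le:
  fixes x y :: "nat \<Rightarrow> real"
  assumes anti: "\<And>i j. 1 \<le> i \<Longrightarrow> i \<le> j \<Longrightarrow> j \<le> N \<Longrightarrow> x j \<le> x i"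
    and x0: "\<And>i. 1 \<le> i \<Longrightarrow> i \<le> N \<Longrightarrow> 0 \<le> x i"
    and part: "\<And>m. m \<le> N \<Longrightarrow> (\<Sum>i=1..m. y i) \<le> 0"
  shows "(\<Sum>i=1..N. x i * y i) \<le> 0"
proof -
  have "m \<le> N \<Longrightarrow> 1 \<le> m \<Longrightarrow> (\<Sum>i=1..m. x i * y i) \<le> x m * (\<Sum>i=1..m. y i)" for m
  proof (induction m)
    case (Suc m)
    show ?case
    proof (cases "m = 0")
      case False
      have "x m * (\<Sum>i=1..m. y i) \<le> x (Suc m) * (\<Sum>i=1..m. y i)"
        using anti[of m "Suc m"] part[of m] Suc.prems False by (intro mult_right_mono_neg) auto
      then show ?thesis using Suc False by (simp add: algebra_simps)
    qed simp
  qed simp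
  from this[of N] show ?thesis
    using mult_nonneg_nonpos[OF x0[of N] part[of N]] by (cases "N = 0") auto
qed

text \<open>
  Both sides count each pair of indices that meets \<open>{1..m}\<close> once.
\<close>

lemma sum_pairs_touching:
  fixes h :: "nat \<Rightarrow> nat \<Rightarrow> real"
  assumes sym: "\<And>p q. h p q = h q p" and diag: "\<And>p. h p p = 0" and "m \<le> N"
  shows "(\<Sum>j=1..m. \<Sum>k=Suc j..N. h j k) = (\<Sum>j=1..m. \<Sum>k=1..N. h j k) - (\<Sum>j=1..m. \<Sum>k=1..m. h j k) / 2"
  using \<open>m \<le> N\<close>
proof (induction m)
  case (Suc m)
  have "{1..N} = {1..m} \<union> {Suc m} \<union> {Suc (Suc m)..N}" using Suc.prems by auto
  then have "(\<Sum>k=1..N. h (Suc m) k) = (\<Sum>k=1..m. h (Suc m) k) + (\<Sum>k=Suc (Suc m)..N. h (Suc m) k)"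
    by (simp add: sum.union_disjoint diag)
  moreover have "(\<Sum>k=1..m. h k (Suc m)) = (\<Sum>k=1..m. h (Suc m) k)" using sym by simp
  ultimately show ?case using Suc by (simp add: sum.distrib diag field_simps)
qed simp

text \<open>
  The inequality \<open>(x + y)\<^sup>2 \<le> 3 * x\<^sup>2 + 3 / 2 * y\<^sup>2\<close> holds since the reciprocals of 3 and 3/2 add up
  to 1. Equality at \<open>y = 2 * x\<close> makes this split the right one: with eigenvalues proportional to
  \<open>-1, -1, 2\<close> on a suitable copy of \<open>so(3)\<close> in \<open>so(4)\<close>, the final estimate can be an equality.
\<close>

lemma ordered_gap_le:
  fixes s t :: real
  assumes "s \<le> t"
  shows "(s - t)\<^sup>2 \<le> 3 * (if s < 0 then s\<^sup>2 else 0) + 3 / 2 * (if t < 0 then 0 else t\<^sup>2)"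
proof -
  have "0 \<le> (2 * s + t)\<^sup>2" by simp
  then have a: "(s - t)\<^sup>2 \<le> 3 * s\<^sup>2 + 3 / 2 * t\<^sup>2" by (simp add: power2_eq_square algebra_simps)
  consider "0 \<le> s" | "s < 0" "t < 0" | "s < 0" "0 \<le> t" by linarith
  then show ?thesis
  proof cases
    case 1
    then have "(t - s)\<^sup>2 \<le> t\<^sup>2" using assms by (intro power_mono) auto
    then have "(s - t)\<^sup>2 \<le> t\<^sup>2" by (simp add: power2_commute)
    moreover have "t\<^sup>2 \<le> 3 / 2 * t\<^sup>2" by simp
    ultimately have "(s - t)\<^sup>2 \<le> 3 / 2 * t\<^sup>2" by (rule order_trans)
    then show ?thesis using 1 assms by simp
  next
    case 2
    then have "(t - s)\<^sup>2 \<le> (- s)\<^sup>2" using assms by (intro power_mono) auto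
    then have "(s - t)\<^sup>2 \<le> s\<^sup>2" by (simp add: power2_commute)
    moreover have "s\<^sup>2 \<le> 3 * s\<^sup>2" by simp
    ultimately have "(s - t)\<^sup>2 \<le> 3 * s\<^sup>2" by (rule order_trans)
    then show ?thesis using 2 by simp
  next
    case 3
    then show ?thesis using a by simp
  qed
qed

lemma triangle_gap_le:
  fixes r s t :: real
  shows "(r - s)\<^sup>2 + (s - t)\<^sup>2 + (t - r)\<^sup>2 \<le> 3 * (r\<^sup>2 + s\<^sup>2 + t\<^sup>2)"
proof -
  have "0 \<le> (r + s + t)\<^sup>2" by simp
  then show ?thesis by (simp add: power2_eq_square algebra_simps)
qed

lemma sum_triple_rotate:
  "(\<Sum>i\<in>F. \<Sum>j\<in>F. \<Sum>k\<in>F. g i j k) = (\<Sum>i\<in>F. \<Sum>j\<in>F. \<Sum>k\<in>F. g j k i)"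
proof -
  have "(\<Sum>i\<in>F. \<Sum>j\<in>F. \<Sum>k\<in>F. g j k i) = (\<Sum>j\<in>F. \<Sum>i\<in>F. \<Sum>k\<in>F. g j k i)"
    by (rule sum.swap)
  also have "\<dots> = (\<Sum>j\<in>F. \<Sum>k\<in>F. \<Sum>i\<in>F. g j k i)"
    by (intro sum.cong refl sum.swap)
  finally show ?thesis by simp
qed

text \<open>
  Each gap is charged to its two ends. Let \<open>F = {1..l}\<close> and let \<open>n j\<close> and \<open>p j\<close> be the squares of
  the negative and of the nonnegative \<open>\<mu> j\<close>. A pair \<open>j < k\<close> is charged to \<open>n j\<close> and \<open>p k\<close> by
  \<open>ordered_gap_le\<close>, except that the three pairs of a triple inside \<open>F\<close> are charged together and
  evenly by \<open>triangle_gap_le\<close>.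

  The charge of \<open>n j\<close> is \<open>6 * C j\<close> with \<open>C j = a j / 2 + b j\<close> for \<open>j \<le> l\<close> and \<open>C j = D j\<close> for
  \<open>j > l\<close>. For \<open>j \<le> l\<close>, the number \<open>C j\<close> is the weight of the pairs meeting \<open>F - {j}\<close> in the graph of
  \<open>j\<close>, so it is at most \<open>l\<close>; this is the reason for the even charging, and it bounds the partial sums
  of \<open>C\<close> up to \<open>m \<le> l\<close>. For \<open>m \<ge> l\<close>, the sum of
  \<open>C 1, \<dots>, C m\<close> is the weight of the pairs meeting \<open>{1..m}\<close> in the graphs of all \<open>i \<le> l\<close>. As \<open>i\<close> is
  isolated in its own graph, these pairs meet \<open>{1..m} - {i}\<close> and have weight at most \<open>m\<close> for each
  \<open>i\<close>. The numbers \<open>n j\<close> decrease, so summation by parts applies.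
\<close>

lemma weighted_gap_sum_le:
  fixes w :: "nat \<Rightarrow> nat \<Rightarrow> nat \<Rightarrow> real" and \<mu> :: "nat \<Rightarrow> real" and N l :: nat
  assumes w12: "\<And>i j k. w i j k = w j i k" and w23: "\<And>i j k. w i j k = w i k j"
    and w0: "\<And>i j k. 0 \<le> w i j k" and diag: "\<And>i j. w i j j = 0"
    and mono: "mono_on {1..N} \<mu>" and "l \<le> N"
    and touching: "\<And>i J. i \<in> {1..N} \<Longrightarrow> J \<subseteq> {1..N} \<Longrightarrow> i \<notin> J \<Longrightarrow>
      (\<Sum>j\<in>J. \<Sum>k=1..N. w i j k) - (\<Sum>j\<in>J. \<Sum>k\<in>J. w i j k) / 2 \<le> real (card J) + 1"
  shows "(\<Sum>i=1..l. \<Sum>j=1..N. \<Sum>k=1..N. w i j k * (\<mu> j - \<mu> k)\<^sup>2) \<le> 6 * real l * (\<Sum>j=1..N. (\<mu> j)\<^sup>2)"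
proof -
  define F O' where "F = {1..l}" and "O' = {Suc l..N}"
  define n p where "n j = (if \<mu> j < 0 then (\<mu> j)\<^sup>2 else 0)" and "p j = (if \<mu> j < 0 then 0 else (\<mu> j)\<^sup>2)" for j
  have np: "(\<mu> j)\<^sup>2 = n j + p j" and n0: "0 \<le> n j" and p0: "0 \<le> p j" for j
    by (auto simp: n_def p_def)
  have [simp]: "finite F" "finite O'" by (auto simp: F_def O'_def)
  have split: "(\<Sum>k=1..N. g k) = sum g F + sum g O'" for g :: "nat \<Rightarrow> real"
  proof -
    have "{1..N} = F \<union> O'" "F \<inter> O' = {}" using \<open>l \<le> N\<close> by (auto simp: F_def O'_def)
    then show ?thesis by (simp add: sum.union_disjoint)
  qed
  have diag12: "w i i k = 0" for i k using w12 w23 diag by metis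
  have gap: "(\<mu> j - \<mu> k)\<^sup>2 \<le> 3 * n j + 3 / 2 * p k" if "1 \<le> j" "j \<le> k" "k \<le> N" for j k
    using ordered_gap_le[of "\<mu> j" "\<mu> k"] mono_onD[OF mono, of j k] that by (simp add: n_def p_def)
  define a b D where "a j = (\<Sum>i\<in>F. \<Sum>k\<in>F. w i j k)" and "b j = (\<Sum>i\<in>F. \<Sum>k\<in>O'. w i j k)"
    and "D j = (\<Sum>i\<in>F. \<Sum>k=Suc j..N. w i j k)" for j

  let ?g = "\<lambda>i j k. w i j k * (\<mu> j - \<mu> k)\<^sup>2"
  have inner: "(\<Sum>i\<in>F. \<Sum>j\<in>F. \<Sum>k\<in>F. ?g i j k) \<le> 3 * (\<Sum>j\<in>F. (n j + p j) * a j)"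
  proof -
    let ?S = "\<lambda>h :: nat \<Rightarrow> nat \<Rightarrow> nat \<Rightarrow> real. \<Sum>i\<in>F. \<Sum>j\<in>F. \<Sum>k\<in>F. w i j k * h i j k"
    have rot: "?S h = ?S (\<lambda>i j k. h j k i)" for h
    proof -
      have "?S h = (\<Sum>i\<in>F. \<Sum>j\<in>F. \<Sum>k\<in>F. w j k i * h j k i)" by (rule sum_triple_rotate)
      moreover have "w j k i = w i j k" for i j k using w12 w23 by metis
      ultimately show ?thesis by simp
    qed
    have "3 * ?S (\<lambda>i j k. (\<mu> j - \<mu> k)\<^sup>2)
        = ?S (\<lambda>i j k. (\<mu> i - \<mu> j)\<^sup>2 + (\<mu> j - \<mu> k)\<^sup>2 + (\<mu> k - \<mu> i)\<^sup>2)"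
      using rot[of "\<lambda>i j k. (\<mu> j - \<mu> k)\<^sup>2"] rot[of "\<lambda>i j k. (\<mu> k - \<mu> i)\<^sup>2"]
      by (simp add: distrib_left sum.distrib)
    also have "\<dots> \<le> ?S (\<lambda>i j k. 3 * ((\<mu> i)\<^sup>2 + (\<mu> j)\<^sup>2 + (\<mu> k)\<^sup>2))"
      by (intro sum_mono mult_left_mono triangle_gap_le w0)
    also have "\<dots> = 3 * (?S (\<lambda>i j k. (\<mu> i)\<^sup>2) + ?S (\<lambda>i j k. (\<mu> j)\<^sup>2) + ?S (\<lambda>i j k. (\<mu> k)\<^sup>2))"
      by (simp add: sum_distrib_left sum.distrib algebra_simps)
    also have "\<dots> = 3 * (3 * ?S (\<lambda>i j k. (\<mu> j)\<^sup>2))"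
      using rot[of "\<lambda>i j k. (\<mu> i)\<^sup>2"] rot[of "\<lambda>i j k. (\<mu> j)\<^sup>2"] by simp
    also have "?S (\<lambda>i j k. (\<mu> j)\<^sup>2) = (\<Sum>j\<in>F. (n j + p j) * a j)"
      unfolding a_def np sum_distrib_left by (subst sum.swap) (simp add: mult.commute)
    finally show ?thesis by simp
  qed
  have mixed: "(\<Sum>i\<in>F. \<Sum>j\<in>F. \<Sum>k\<in>O'. ?g i j k) \<le> 3 * (\<Sum>j\<in>F. n j * b j) + 3 / 2 * (\<Sum>k\<in>O'. p k * a k)"
  proof -
    have "(\<Sum>i\<in>F. \<Sum>j\<in>F. \<Sum>k\<in>O'. ?g i j k)
        \<le> (\<Sum>i\<in>F. \<Sum>j\<in>F. \<Sum>k\<in>O'. w i j k * (3 * n j + 3 / 2 * p k))"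
      by (intro sum_mono mult_left_mono gap w0) (auto simp: F_def O'_def)
    also have "\<dots> = 3 * (\<Sum>i\<in>F. \<Sum>j\<in>F. \<Sum>k\<in>O'. w i j k * n j)
                 + 3 / 2 * (\<Sum>i\<in>F. \<Sum>j\<in>F. \<Sum>k\<in>O'. w i j k * p k)"
      by (simp add: sum_distrib_left sum.distrib algebra_simps)
    also have "(\<Sum>i\<in>F. \<Sum>j\<in>F. \<Sum>k\<in>O'. w i j k * n j) = (\<Sum>j\<in>F. n j * b j)"
      unfolding b_def sum_distrib_left by (subst sum.swap) (simp add: mult.commute)
    also have "(\<Sum>i\<in>F. \<Sum>j\<in>F. \<Sum>k\<in>O'. w i j k * p k) = (\<Sum>i\<in>F. \<Sum>k\<in>O'. \<Sum>j\<in>F. w i j k * p k)"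
      by (intro sum.cong refl sum.swap)
    also have "\<dots> = (\<Sum>k\<in>O'. \<Sum>i\<in>F. \<Sum>j\<in>F. w i j k * p k)" by (rule sum.swap)
    also have "\<dots> = (\<Sum>k\<in>O'. p k * a k)"
    proof -
      have ak: "(\<Sum>i\<in>F. \<Sum>j\<in>F. w i j k) = a k" for k
        unfolding a_def by (intro sum.cong refl w23)
      show ?thesis by (simp only: sum_distrib_right[symmetric] ak mult.commute[of "p _"])
    qed
    finally show ?thesis .
  qed
  have outer: "(\<Sum>i\<in>F. \<Sum>j\<in>O'. \<Sum>k\<in>O'. ?g i j k) \<le> 6 * (\<Sum>j\<in>O'. n j * D j) + 3 * (\<Sum>k\<in>O'. p k * b k)"
  proof -
    have O'_pairs: "(\<Sum>j\<in>O'. \<Sum>k\<in>O'. h j k) = 2 * (\<Sum>j\<in>O'. \<Sum>k=Suc j..N. h j k)"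
      if sym: "\<And>j k. h j k = h k j" and h0: "\<And>j. h j j = 0" for h :: "nat \<Rightarrow> nat \<Rightarrow> real"
    proof -
      have "(\<Sum>k\<in>O'. h j k) = (\<Sum>k\<in>O'. if k < j then h j k else 0) + (\<Sum>k\<in>O'. if j < k then h j k else 0)" for j
        unfolding sum.distrib[symmetric] by (rule sum.cong) (auto simp: h0 not_less less_le)
      then have "(\<Sum>j\<in>O'. \<Sum>k\<in>O'. h j k) = (\<Sum>j\<in>O'. \<Sum>k\<in>O'. if k < j then h j k else 0)
          + (\<Sum>j\<in>O'. \<Sum>k\<in>O'. if j < k then h j k else 0)"
        by (simp add: sum.distrib)
      also have "(\<Sum>j\<in>O'. \<Sum>k\<in>O'. if k < j then h j k else 0) = (\<Sum>j\<in>O'. \<Sum>k\<in>O'. if j < k then h j k else 0)"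
        by (subst sum.swap) (intro sum.cong refl, simp add: sym)
      also have "(\<Sum>j\<in>O'. \<Sum>k\<in>O'. if j < k then h j k else 0) = (\<Sum>j\<in>O'. \<Sum>k=Suc j..N. h j k)"
      proof (rule sum.cong[OF refl])
        fix j assume "j \<in> O'"
        have "(\<Sum>k=Suc j..N. h j k) = (\<Sum>k=Suc j..N. if j < k then h j k else 0)"
          by (rule sum.cong) auto
        also have "\<dots> = (\<Sum>k\<in>O'. if j < k then h j k else 0)"
          using \<open>j \<in> O'\<close> by (intro sum.mono_neutral_left) (auto simp: O'_def)
        finally show "(\<Sum>k\<in>O'. if j < k then h j k else 0) = (\<Sum>k=Suc j..N. h j k)" by simp
      qed
      finally show ?thesis by simp
    qed
    have "(\<Sum>i\<in>F. \<Sum>j\<in>O'. \<Sum>k\<in>O'. ?g i j k) = 2 * (\<Sum>i\<in>F. \<Sum>j\<in>O'. \<Sum>k=Suc j..N. ?g i j k)"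
      unfolding sum_distrib_left[of 2 _ F]
      by (intro sum.cong refl O'_pairs) (simp_all add: w23 power2_commute)
    also have "\<dots> \<le> 2 * (\<Sum>i\<in>F. \<Sum>j\<in>O'. \<Sum>k=Suc j..N. w i j k * (3 * n j + 3 / 2 * p k))"
      by (intro mult_left_mono sum_mono gap w0) (auto simp: O'_def)
    also have "\<dots> = 6 * (\<Sum>i\<in>F. \<Sum>j\<in>O'. \<Sum>k=Suc j..N. w i j k * n j)
                 + 3 * (\<Sum>i\<in>F. \<Sum>j\<in>O'. \<Sum>k=Suc j..N. w i j k * p k)"
      by (simp add: sum_distrib_left sum.distrib algebra_simps)
    also have "(\<Sum>i\<in>F. \<Sum>j\<in>O'. \<Sum>k=Suc j..N. w i j k * n j) = (\<Sum>j\<in>O'. n j * D j)"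
      unfolding D_def sum_distrib_left by (subst sum.swap) (simp add: mult.commute)
    also have "(\<Sum>i\<in>F. \<Sum>j\<in>O'. \<Sum>k=Suc j..N. w i j k * p k) \<le> (\<Sum>i\<in>F. \<Sum>j\<in>O'. \<Sum>k\<in>O'. w i j k * p k)"
      by (intro sum_mono sum_mono2 mult_nonneg_nonneg w0 p0) (auto simp: O'_def)
    also have "\<dots> = (\<Sum>k\<in>O'. p k * b k)"
    proof -
      have "(\<Sum>i\<in>F. \<Sum>j\<in>O'. \<Sum>k\<in>O'. w i j k * p k) = (\<Sum>i\<in>F. \<Sum>k\<in>O'. \<Sum>j\<in>O'. w i j k * p k)"
        by (intro sum.cong refl sum.swap)
      also have "\<dots> = (\<Sum>k\<in>O'. \<Sum>i\<in>F. \<Sum>j\<in>O'. w i j k * p k)" by (rule sum.swap)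
      also have "\<dots> = (\<Sum>k\<in>O'. p k * b k)"
      proof -
        have bk: "(\<Sum>i\<in>F. \<Sum>j\<in>O'. w i j k) = b k" for k
          unfolding b_def by (intro sum.cong refl w23)
        show ?thesis by (simp only: sum_distrib_right[symmetric] bk mult.commute[of "p _"])
      qed
      finally show ?thesis .
    qed
    finally show ?thesis by simp
  qed
  have "(\<Sum>i=1..l. \<Sum>j=1..N. \<Sum>k=1..N. ?g i j k)
      = (\<Sum>i\<in>F. \<Sum>j\<in>F. \<Sum>k\<in>F. ?g i j k) + 2 * (\<Sum>i\<in>F. \<Sum>j\<in>F. \<Sum>k\<in>O'. ?g i j k)
        + (\<Sum>i\<in>F. \<Sum>j\<in>O'. \<Sum>k\<in>O'. ?g i j k)"
  proof -
    have "(\<Sum>j\<in>O'. \<Sum>k\<in>F. ?g i j k) = (\<Sum>j\<in>F. \<Sum>k\<in>O'. ?g i j k)" for i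
      by (subst sum.swap) (simp add: w23[of i] power2_commute)
    then show ?thesis unfolding split F_def[symmetric] by (simp add: sum.distrib sum_distrib_left)
  qed
  also have "\<dots> \<le> 6 * (\<Sum>j=1..N. n j * (if j \<le> l then a j / 2 + b j else D j)) + 3 * (\<Sum>k=1..N. p k * (a k + b k))"
  proof -
    have "(\<Sum>j=1..N. n j * (if j \<le> l then a j / 2 + b j else D j))
        = (\<Sum>j\<in>F. n j * a j) / 2 + (\<Sum>j\<in>F. n j * b j) + (\<Sum>j\<in>O'. n j * D j)"
      unfolding split by (simp add: F_def O'_def sum.distrib[symmetric] sum_divide_distrib algebra_simps)
    moreover have "(\<Sum>k=1..N. p k * (a k + b k)) = (\<Sum>k\<in>F. p k * a k) + (\<Sum>k\<in>F. p k * b k) + (\<Sum>k\<in>O'. p k * a k) + (\<Sum>k\<in>O'. p k * b k)"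
      unfolding split by (simp add: sum.distrib distrib_left)
    moreover have "(\<Sum>j\<in>F. (n j + p j) * a j) = (\<Sum>j\<in>F. n j * a j) + (\<Sum>k\<in>F. p k * a k)"
      by (simp add: sum.distrib distrib_right)
    moreover have "0 \<le> (\<Sum>k\<in>F. p k * b k)"
      by (intro sum_nonneg mult_nonneg_nonneg p0) (auto simp: b_def intro!: sum_nonneg w0)
    ultimately show ?thesis using inner mixed outer by linarith
  qed
  also have "\<dots> \<le> 6 * (real l * (\<Sum>j=1..N. n j)) + 3 * (2 * real l * (\<Sum>k=1..N. p k))"
  proof (intro add_mono mult_left_mono)
    have "(\<Sum>j=1..N. n j * ((if j \<le> l then a j / 2 + b j else D j) - real l)) \<le> 0"
    proof (rule sum_mult_antitone_le)
      fix i j assume "1 \<le> i" "i \<le> j" "j \<le> N"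
      then have "\<mu> i \<le> \<mu> j" using mono_onD[OF mono, of i j] by simp
      then show "n j \<le> n i"
        using power_mono[of "- \<mu> j" "- \<mu> i" 2] by (auto simp: n_def)
    next
      fix m assume "m \<le> N"
      \<comment> \<open>By symmetry of \<open>w\<close>, the weights at \<open>j\<close> are those of the graph of \<open>j\<close>.\<close>
      have le_l: "a j / 2 + b j \<le> real l" if "j \<in> F" for j
      proof -
        have drop: "(\<Sum>i\<in>F - {j}. g i) = sum g F" if "g j = 0" for g :: "nat \<Rightarrow> real"
          by (rule sum.mono_neutral_left) (use that in auto)
        have "(\<Sum>i\<in>F - {j}. \<Sum>k=1..N. w j i k) - (\<Sum>i\<in>F - {j}. \<Sum>k\<in>F - {j}. w j i k) / 2
            \<le> real (card (F - {j})) + 1"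
          using that \<open>l \<le> N\<close> by (intro touching) (auto simp: F_def)
        moreover have "(\<Sum>i\<in>F - {j}. \<Sum>k=1..N. w j i k) = a j + b j"
          unfolding a_def b_def split sum.distrib[symmetric]
          by (subst drop) (simp_all add: diag12 w12[of j])
        moreover have "(\<Sum>i\<in>F - {j}. \<Sum>k\<in>F - {j}. w j i k) = a j"
        proof -
          have "(\<Sum>k\<in>F - {j}. w j i k) = (\<Sum>k\<in>F. w j i k)" for i
            by (rule drop) (simp add: w23[of j i] diag12)
          moreover have "(\<Sum>i\<in>F - {j}. \<Sum>k\<in>F. w j i k) = (\<Sum>i\<in>F. \<Sum>k\<in>F. w j i k)"
            by (rule drop) (simp add: diag12)
          ultimately show ?thesis unfolding a_def by (simp add: w12[of j])
        qed
        moreover have "real (card (F - {j})) + 1 = real l"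
          using that by (simp add: F_def)
        ultimately show ?thesis by simp
      qed
      show "(\<Sum>j=1..m. (if j \<le> l then a j / 2 + b j else D j) - real l) \<le> 0"
      proof (cases "m \<le> l")
        case True
        then show ?thesis using le_l by (intro sum_nonpos) (auto simp: F_def)
      next
        case False
        have ms: "{1..m} = F \<union> {Suc l..m}" "F \<inter> {Suc l..m} = {}" using False by (auto simp: F_def)
        \<comment> \<open>Over the whole of \<open>F\<close>, charging evenly and charging the lower end amount to the same.\<close>
        have "(\<Sum>j\<in>F. a j / 2 + b j) = (\<Sum>j\<in>F. D j)"
        proof -
          have "(\<Sum>j\<in>F. D j) = (\<Sum>i\<in>F. \<Sum>j=1..l. \<Sum>k=Suc j..N. w i j k)"
            unfolding D_def by (subst sum.swap) (simp add: F_def)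
          also have "\<dots> = (\<Sum>i\<in>F. (\<Sum>j=1..l. \<Sum>k=1..N. w i j k) - (\<Sum>j=1..l. \<Sum>k=1..l. w i j k) / 2)"
            by (intro sum.cong refl sum_pairs_touching w23 diag \<open>l \<le> N\<close>)
          also have "\<dots> = (\<Sum>j\<in>F. a j + b j) - (\<Sum>j\<in>F. a j) / 2"
          proof -
            have "(\<Sum>i\<in>F. \<Sum>j\<in>F. \<Sum>k\<in>F. w i j k) = (\<Sum>j\<in>F. a j)"
              "(\<Sum>i\<in>F. \<Sum>j\<in>F. \<Sum>k\<in>O'. w i j k) = (\<Sum>j\<in>F. b j)"
              unfolding a_def b_def by (rule sum.swap)+
            then show ?thesis
              unfolding split F_def[symmetric] by (simp add: sum_subtractf sum.distrib sum_divide_distrib[symmetric])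
          qed
          finally show ?thesis by (simp add: sum.distrib sum_divide_distrib[symmetric])
        qed
        then have "(\<Sum>j=1..m. if j \<le> l then a j / 2 + b j else D j) = (\<Sum>j=1..m. D j)"
          unfolding ms(1) by (subst (1 2) sum.union_disjoint) (use ms(2) in \<open>auto simp: F_def\<close>)
        also have "\<dots> = (\<Sum>i\<in>F. \<Sum>j=1..m. \<Sum>k=Suc j..N. w i j k)"
          unfolding D_def by (rule sum.swap)
        also have "\<dots> \<le> (\<Sum>i\<in>F. real m)"
        proof (rule sum_mono)
          fix i assume i: "i \<in> F"
          let ?J = "{1..m} - {i}"
          have drop: "(\<Sum>j\<in>?J. g j) = sum g {1..m}" if "g i = 0" for g :: "nat \<Rightarrow> real"
            by (rule sum.mono_neutral_left) (use that in auto)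
          have "(\<Sum>j\<in>?J. \<Sum>k=1..N. w i j k) - (\<Sum>j\<in>?J. \<Sum>k\<in>?J. w i j k) / 2 \<le> real (card ?J) + 1"
            using i \<open>l \<le> N\<close> \<open>m \<le> N\<close> by (intro touching) (auto simp: F_def)
          moreover have "(\<Sum>k\<in>?J. w i j k) = (\<Sum>k=1..m. w i j k)" for j
            by (rule drop) (simp add: w23[of i j] diag12)
          moreover have "(\<Sum>j\<in>?J. \<Sum>k=1..N. w i j k) = (\<Sum>j=1..m. \<Sum>k=1..N. w i j k)"
            by (rule drop) (simp add: diag12)
          moreover have "(\<Sum>j\<in>?J. \<Sum>k=1..m. w i j k) = (\<Sum>j=1..m. \<Sum>k=1..m. w i j k)"
            by (rule drop) (simp add: diag12)
          moreover have "real (card ?J) + 1 = real m" using i False by (simp add: F_def)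
          ultimately show "(\<Sum>j=1..m. \<Sum>k=Suc j..N. w i j k) \<le> real m"
            using sum_pairs_touching[of "w i" m N] w23 diag \<open>m \<le> N\<close> by simp
        qed
        finally show ?thesis by (simp add: sum_subtractf F_def mult.commute)
      qed
    qed (rule n0)
    then show "(\<Sum>j=1..N. n j * (if j \<le> l then a j / 2 + b j else D j)) \<le> real l * (\<Sum>j=1..N. n j)"
      by (simp add: right_diff_distrib sum_subtractf sum_distrib_left mult.commute)
    have "a k + b k \<le> 2 * real l" if k: "k \<in> {1..N}" for k
    proof -
      have "(\<Sum>k'=1..N. w i k k') \<le> 2" if "i \<in> F" for i
      proof (cases "i = k")
        case False
        \<comment> \<open>The case of a single vertex: \<open>\<bar>[\<eta> i, \<eta> k]\<bar>\<^sup>2 \<le> 2\<close>.\<close>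
        then show ?thesis using touching[of i "{k}"] that k \<open>l \<le> N\<close> by (simp add: diag F_def)
      qed (simp add: diag12)
      then have "(\<Sum>i\<in>F. \<Sum>k'=1..N. w i k k') \<le> (\<Sum>i\<in>F. 2)" by (rule sum_mono)
      then show ?thesis unfolding a_def b_def split by (simp add: sum.distrib F_def)
    qed
    then have "(\<Sum>k=1..N. p k * (a k + b k)) \<le> (\<Sum>k=1..N. p k * (2 * real l))"
      by (intro sum_mono mult_left_mono p0)
    then show "(\<Sum>k=1..N. p k * (a k + b k)) \<le> 2 * real l * (\<Sum>k=1..N. p k)"
      by (simp add: sum_distrib_left mult.commute)
  qed auto
  also have "\<dots> = 6 * real l * (\<Sum>j=1..N. (\<mu> j)\<^sup>2)"
    by (simp add: np sum.distrib algebra_simps)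
  finally show ?thesis .
qed

section \<open>Traces and norms in orthonormal bases\<close>

lemma endomorphism_on_sum:
  assumes f: "endomorphism_on S f" and S: "subspace S" and "finite I" "\<And>i. i \<in> I \<Longrightarrow> u i \<in> S"
  shows "f (\<Sum>i\<in>I. c i *\<^sub>R u i) = (\<Sum>i\<in>I. c i *\<^sub>R f (u i))"
  using assms(3,4)
proof (induction I)
  case empty
  have "f (0 *\<^sub>R 0) = 0 *\<^sub>R f 0" using f subspace_0[OF S] unfolding endomorphism_on_def by blast
  then show ?case by simp
next
  case (insert i I)
  have "c i *\<^sub>R u i \<in> S" "(\<Sum>i\<in>I. c i *\<^sub>R u i) \<in> S"
    using insert.prems S by (auto intro!: subspace_scale subspace_sum)
  then have "f (c i *\<^sub>R u i + (\<Sum>i\<in>I. c i *\<^sub>R u i)) = c i *\<^sub>R f (u i) + f (\<Sum>i\<in>I. c i *\<^sub>R u i)"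
    using f insert.prems unfolding endomorphism_on_def by simp
  then show ?case using insert by simp
qed

text \<open>
  The trace may be computed from any finite coordinate system of \<open>S\<close>, such as an orthonormal basis
  and the inner products with it: expanding first the chosen basis in the coordinates and then
  the images \<open>f (u i)\<close> in the chosen basis exchanges the two systems.
\<close>

lemma trace_on_coordinates:
  assumes S: "subspace S" and f: "endomorphism_on S f" and I: "finite I"
    and u: "\<And>i. i \<in> I \<Longrightarrow> u i \<in> S" and \<phi>: "\<And>i. i \<in> I \<Longrightarrow> linear (\<phi> i)"
    and rep: "\<And>x. x \<in> S \<Longrightarrow> (\<Sum>i\<in>I. \<phi> i x *\<^sub>R u i) = x"
  shows "trace_on S f = (\<Sum>i\<in>I. \<phi> i (f (u i)))"
proof -
  define B where "B = (SOME B. independent B \<and> span B = S)"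
  obtain B0 where "B0 \<subseteq> S" "independent B0" "S \<subseteq> span B0"
    using basis_exists[of S] by metis
  then have "independent B0 \<and> span B0 = S" using span_minimal[OF _ S] by blast
  then have "independent B \<and> span B = S" unfolding B_def by (rule someI)
  then have B: "independent B" "span B = S" by auto
  have BS: "b \<in> S" if "b \<in> B" for b using B(2) span_base[OF that] by simp
  have "S \<subseteq> span (u ` I)"
  proof
    fix x assume "x \<in> S"
    then have "x = (\<Sum>i\<in>I. \<phi> i x *\<^sub>R u i)" by (simp add: rep)
    also have "\<dots> \<in> span (u ` I)" by (intro span_sum span_scale span_base) auto
    finally show "x \<in> span (u ` I)" .
  qed
  then have finB: "finite B"
    using independent_span_bound[of "u ` I" B] B I span_superset[of B] by blast
  have fu: "f (u i) \<in> S" if "i \<in> I" for i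
    using f u[OF that] by (simp add: endomorphism_on_def)
  have "representation B (f b) b = (\<Sum>i\<in>I. \<phi> i b * representation B (f (u i)) b)" if "b \<in> B" for b
  proof -
    have "f b = (\<Sum>i\<in>I. \<phi> i b *\<^sub>R f (u i))"
      using endomorphism_on_sum[OF f S I, where u = u and c = "\<lambda>i. \<phi> i b", OF u] rep[OF BS[OF that]] by simp
    then have "representation B (f b) = representation B (\<Sum>i\<in>I. \<phi> i b *\<^sub>R f (u i))"
      by (rule arg_cong)
    also have "\<dots> = (\<lambda>c. \<Sum>i\<in>I. representation B (\<phi> i b *\<^sub>R f (u i)) c)"
      using fu by (intro representation_sum B(1)) (auto simp: B(2) intro!: subspace_scale S)
    finally show ?thesis
      using fu by (simp add: representation_scale[OF B(1)] B(2))
  qed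
  then have "trace_on S f = (\<Sum>b\<in>B. \<Sum>i\<in>I. \<phi> i b * representation B (f (u i)) b)"
    unfolding trace_on_def B_def[symmetric] Let_def by (rule sum.cong[OF refl])
  also have "\<dots> = (\<Sum>i\<in>I. \<Sum>b\<in>B. \<phi> i b * representation B (f (u i)) b)" by (rule sum.swap)
  also have "\<dots> = (\<Sum>i\<in>I. \<phi> i (f (u i)))"
  proof (rule sum.cong[OF refl])
    fix i assume i: "i \<in> I"
    have "f (u i) = (\<Sum>b\<in>B. representation B (f (u i)) b *\<^sub>R b)"
      using sum_representation_eq[OF B(1) _ finB order_refl] fu[OF i] B(2) by simp
    then have "\<phi> i (f (u i)) = \<phi> i (\<Sum>b\<in>B. representation B (f (u i)) b *\<^sub>R b)" by (rule arg_cong)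
    also have "\<dots> = (\<Sum>b\<in>B. \<phi> i b * representation B (f (u i)) b)"
      by (simp add: linear_sum[OF \<phi>[OF i]] linear_scale[OF \<phi>[OF i]] mult.commute)
    finally show "(\<Sum>b\<in>B. \<phi> i b * representation B (f (u i)) b) = \<phi> i (f (u i))" by simp
  qed
  finally show ?thesis .
qed

lemma lie_inner_eq_endo_inner:
  assumes "L \<in> skew_endos"
  shows "lie_inner L X = endo_inner L X"
proof -
  have "trace_on UNIV (blinfun_apply (L o\<^sub>L X)) = (\<Sum>b\<in>Basis. (L o\<^sub>L X) b \<bullet> b)"
    by (rule trace_on_coordinates[where \<phi> = "\<lambda>b x. x \<bullet> b"])
      (auto simp: endomorphism_on_def blinfun.add_right blinfun.scaleR_right euclidean_representation
        intro!: linearI simp: inner_add_left)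
  also have "\<dots> = - (\<Sum>b\<in>Basis. L b \<bullet> X b)"
    by (simp add: skewD[OF assms, of "X _"] sum_negf inner_commute[of "X _"])
  finally show ?thesis by (simp add: lie_inner_def endo_inner_def)
qed

locale orthonormal_basis_of =
  fixes G :: "('v::euclidean_space \<Rightarrow>\<^sub>L 'v) set" and I :: "'i set" and \<eta> :: "'i \<Rightarrow> ('v \<Rightarrow>\<^sub>L 'v)"
  assumes subspace: "subspace G" and skew: "G \<subseteq> skew_endos" and finite: "finite I"
    and orth: "orthonormal_endos I \<eta>" and span: "span (\<eta> ` I) = G"
begin

lemma mem: "i \<in> I \<Longrightarrow> \<eta> i \<in> G"
  using span span_base[of "\<eta> i" "\<eta> ` I"] by auto

lemma inner_basis: "i \<in> I \<Longrightarrow> j \<in> I \<Longrightarrow> endo_inner (\<eta> i) (\<eta> j) = (if i = j then 1 else 0)"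
  using orth by (simp add: orthonormal_endos_def)

lemma expansion:
  assumes "X \<in> G" shows "(\<Sum>i\<in>I. endo_inner X (\<eta> i) *\<^sub>R \<eta> i) = X"
proof -
  have "X \<in> span (\<eta> ` I)" using assms span by simp
  then show ?thesis
  proof (induction rule: span_induct_alt)
    case base
    then show ?case by (simp add: endo_inner_simps)
  next
    case (step c x y)
    then obtain j where j: "j \<in> I" "x = \<eta> j" by auto
    have "(\<Sum>i\<in>I. endo_inner (\<eta> j) (\<eta> i) *\<^sub>R \<eta> i) = (\<Sum>i\<in>I. if i = j then \<eta> j else 0)"
      using j by (intro sum.cong) (auto simp: inner_basis)
    then have "(\<Sum>i\<in>I. endo_inner (\<eta> j) (\<eta> i) *\<^sub>R \<eta> i) = \<eta> j" using j finite by simp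
    then show ?case using step
      by (simp add: j endo_inner_simps scaleR_left_distrib sum.distrib scaleR_sum_right[symmetric]
          flip: scaleR_scaleR)
  qed
qed

lemma parseval:
  assumes "X \<in> G" shows "endo_inner X Y = (\<Sum>i\<in>I. endo_inner X (\<eta> i) * endo_inner (\<eta> i) Y)"
  by (subst expansion[OF assms, symmetric]) (simp add: endo_inner_sum endo_inner_simps)

lemma hs_norm_square:
  assumes A: "endomorphism_on G A"
  shows "(hs_norm G A)\<^sup>2 = (\<Sum>i\<in>I. endo_inner (A (\<eta> i)) (A (\<eta> i)))"
proof -
  have AG: "A X \<in> G" if "X \<in> G" for X using A that by (simp add: endomorphism_on_def)
  \<comment> \<open>The adjoint, written down in the basis.\<close>
  define A' where "A' X = (\<Sum>i\<in>I. endo_inner X (A (\<eta> i)) *\<^sub>R \<eta> i)" for X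
  have A'G: "A' X \<in> G" for X
    unfolding A'_def by (intro subspace_sum subspace subspace_scale mem)
  have lie: "lie_inner X Y = endo_inner X Y" if "X \<in> G" for X Y
    using that skew by (intro lie_inner_eq_endo_inner) auto
  have A': "endo_inner (A' X) Y = endo_inner X (A Y)" if "X \<in> G" "Y \<in> G" for X Y
  proof -
    have "A Y = (\<Sum>i\<in>I. endo_inner Y (\<eta> i) *\<^sub>R A (\<eta> i))"
      using endomorphism_on_sum[OF A subspace finite, where u = \<eta> and c = "\<lambda>i. endo_inner Y (\<eta> i)", OF mem] expansion[OF that(2)]
      by simp
    then show ?thesis
      by (simp add: A'_def endo_inner_sum endo_inner_simps endo_inner_commute[of Y] mult.commute)
  qed
  have adj: "adjoint_on G A X = A' X" if "X \<in> G" for X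
    unfolding adjoint_on_def
  proof (rule the_equality)
    show "A' X \<in> G \<and> (\<forall>Y\<in>G. lie_inner (A' X) Y = lie_inner X (A Y))"
      using A'G A' that by (simp add: lie)
    fix Z assume Z: "Z \<in> G \<and> (\<forall>Y\<in>G. lie_inner Z Y = lie_inner X (A Y))"
    then have "Z - A' X \<in> G" using A'G subspace by (simp add: subspace_diff)
    moreover have "endo_inner (Z - A' X) Y = 0" if "Y \<in> G" for Y
      using Z A'[OF \<open>X \<in> G\<close> that] lie[of Z Y] lie[OF \<open>X \<in> G\<close>] that
      by (simp add: endo_inner_simps)
    ultimately have "endo_inner (Z - A' X) (Z - A' X) = 0" by blast
    then show "Z = A' X" by (simp add: endo_inner_self_eq_0_iff)
  qed
  have endo: "endomorphism_on G (adjoint_on G A \<circ> A)"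
  proof -
    have "A' (X + Y) = A' X + A' Y" "A' (c *\<^sub>R X) = c *\<^sub>R A' X" for X Y c
      by (simp_all add: A'_def endo_inner_simps scaleR_left_distrib sum.distrib scaleR_sum_right)
    then show ?thesis
      using A subspace by (auto simp: endomorphism_on_def adj A'G subspace_add subspace_scale)
  qed
  have "trace_on G (adjoint_on G A \<circ> A) = (\<Sum>i\<in>I. endo_inner ((adjoint_on G A \<circ> A) (\<eta> i)) (\<eta> i))"
    by (rule trace_on_coordinates[OF subspace endo finite mem linear_endo_inner_left expansion])
  also have "\<dots> = (\<Sum>i\<in>I. endo_inner (A (\<eta> i)) (A (\<eta> i)))"
    by (rule sum.cong) (simp_all add: adj AG mem A')
  finally show ?thesis
    by (simp add: hs_norm_def sum_nonneg endo_inner_self_nonneg)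
qed

end

section \<open>The estimate for a Lie subalgebra\<close>

lemma lie_bracket_add_right: "lie_bracket L (X + Y) = lie_bracket L X + lie_bracket L Y"
  by (rule blinfun_eqI) (simp add: lie_bracket_apply blinfun.add_left blinfun.add_right)

lemma lie_bracket_scaleR_right: "lie_bracket L (c *\<^sub>R X) = c *\<^sub>R lie_bracket L X"
  by (rule blinfun_eqI)
    (simp add: lie_bracket_apply blinfun.scaleR_left blinfun.scaleR_right scaleR_diff_right)

lemma lie_bracket_antisym: "lie_bracket L X = - lie_bracket X L"
  by (simp add: lie_bracket_def)

lemma endomorphism_on_lie_act:
  assumes G: "lie_subalgebra G" and T: "endomorphism_on G T" and L: "L \<in> G"
  shows "endomorphism_on G (lie_act L T)"
proof -
  have br: "lie_bracket L X \<in> G" if "X \<in> G" for X using G L that by (simp add: lie_subalgebra_def)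
  show ?thesis
    using T br G
    by (auto simp: endomorphism_on_def lie_act_def lie_subalgebra_def subspace_diff
        lie_bracket_add_right lie_bracket_scaleR_right scaleR_diff_right)
qed

text \<open>
  The squared norms on both sides are computed in the eigenbasis, with \<open>w i j k\<close> the squared structure
  constants. They are symmetric in all three indices because \<open>ad\<close> is skew. Indices outside of \<open>{1..dim G}\<close> are
  sent to the zero endomorphism, so that the symmetry holds for all natural numbers.
\<close>

lemma lie_act_sum_le:
  fixes G :: "('v::euclidean_space \<Rightarrow>\<^sub>L 'v) set"
  assumes G: "lie_subalgebra G" and T: "self_adjoint_on G T"
    and basis: "ordered_eigenbasis G T \<eta> \<mu>" and l: "l \<le> dim G"
  shows "(\<Sum>i=1..l. (hs_norm G (lie_act (\<eta> i) T))\<^sup>2) \<le> 6 * real l * (hs_norm G T)\<^sup>2"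
proof -
  define I where "I = {1..dim G}"
  have sub: "subspace G" and skew: "G \<subseteq> skew_endos"
    and br: "\<And>X Y. X \<in> G \<Longrightarrow> Y \<in> G \<Longrightarrow> lie_bracket X Y \<in> G"
    using G by (auto simp: lie_subalgebra_def)
  have endoT: "endomorphism_on G T" using T by (simp add: self_adjoint_on_def)
  have span: "span (\<eta> ` I) = G" and eig: "\<And>i. i \<in> I \<Longrightarrow> T (\<eta> i) = \<mu> i *\<^sub>R \<eta> i" and mono: "mono_on I \<mu>"
    using basis by (auto simp: ordered_eigenbasis_def I_def)
  have mem: "\<eta> i \<in> G" if "i \<in> I" for i using span span_base[of "\<eta> i" "\<eta> ` I"] that by auto
  have lie: "lie_inner X Y = endo_inner X Y" if "X \<in> G" for X Y
    using that skew by (intro lie_inner_eq_endo_inner) auto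
  interpret orthonormal_basis_of G I \<eta>
  proof
    show "orthonormal_endos I \<eta>"
      using basis by (auto simp: orthonormal_endos_def ordered_eigenbasis_def I_def lie[OF mem, unfolded I_def, symmetric])
  qed (use sub skew span in \<open>simp_all add: I_def\<close>)
  define \<eta>' where "\<eta>' i = (if i \<in> I then \<eta> i else 0)" for i
  define w where "w i j k = (endo_inner (lie_bracket (\<eta>' i) (\<eta>' j)) (\<eta>' k))\<^sup>2" for i j k
  have w_eq: "w i j k = (endo_inner (lie_bracket (\<eta> i) (\<eta> j)) (\<eta> k))\<^sup>2"
    if "i \<in> I" "j \<in> I" "k \<in> I" for i j k using that by (simp add: w_def \<eta>'_def)
  have skew': "\<eta>' i \<in> skew_endos" for i
    using mem skew subspace_0[OF subspace_skew_endos] by (auto simp: \<eta>'_def)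
  have Tinner: "endo_inner (T X) (\<eta> k) = \<mu> k * endo_inner X (\<eta> k)" if "X \<in> G" "k \<in> I" for X k
  proof -
    have "T X \<in> G" using endoT that by (simp add: endomorphism_on_def)
    then have "endo_inner (T X) (\<eta> k) = endo_inner X (T (\<eta> k))"
      using T that mem[OF that(2)] by (simp add: self_adjoint_on_def lie[symmetric])
    then show ?thesis by (simp add: eig that endo_inner_simps)
  qed
  have sq: "endo_inner X X = (\<Sum>k\<in>I. (endo_inner X (\<eta> k))\<^sup>2)" if "X \<in> G" for X
    using parseval[OF that, of X] by (simp add: power2_eq_square endo_inner_commute[of "\<eta> _" X])
  have act: "(hs_norm G (lie_act (\<eta> i) T))\<^sup>2 = (\<Sum>j\<in>I. \<Sum>k\<in>I. w i j k * (\<mu> j - \<mu> k)\<^sup>2)" if i: "i \<in> I" for i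
  proof -
    have endo: "endomorphism_on G (lie_act (\<eta> i) T)"
      by (rule endomorphism_on_lie_act[OF G endoT mem[OF i]])
    have "endo_inner (lie_act (\<eta> i) T (\<eta> j)) (lie_act (\<eta> i) T (\<eta> j)) = (\<Sum>k\<in>I. w i j k * (\<mu> j - \<mu> k)\<^sup>2)"
      if j: "j \<in> I" for j
    proof -
      have "lie_act (\<eta> i) T (\<eta> j) \<in> G" using endo mem[OF j] by (simp add: endomorphism_on_def)
      then have "endo_inner (lie_act (\<eta> i) T (\<eta> j)) (lie_act (\<eta> i) T (\<eta> j))
          = (\<Sum>k\<in>I. (endo_inner (lie_act (\<eta> i) T (\<eta> j)) (\<eta> k))\<^sup>2)" by (rule sq)
      also have "\<dots> = (\<Sum>k\<in>I. w i j k * (\<mu> j - \<mu> k)\<^sup>2)"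
      proof (rule sum.cong[OF refl])
        fix k assume k: "k \<in> I"
        have "endo_inner (lie_act (\<eta> i) T (\<eta> j)) (\<eta> k) = endo_inner (lie_bracket (\<eta> i) (\<eta> j)) (\<eta> k) * (\<mu> j - \<mu> k)"
          using Tinner[OF br[OF mem[OF i] mem[OF j]] k]
          by (simp add: lie_act_def eig[OF j] lie_bracket_scaleR_right endo_inner_simps algebra_simps)
        then show "(endo_inner (lie_act (\<eta> i) T (\<eta> j)) (\<eta> k))\<^sup>2 = w i j k * (\<mu> j - \<mu> k)\<^sup>2"
          by (simp add: w_eq i j k power_mult_distrib)
      qed
      finally show ?thesis .
    qed
    then show ?thesis by (simp add: hs_norm_square[OF endo])
  qed
  have normT: "(hs_norm G T)\<^sup>2 = (\<Sum>j\<in>I. (\<mu> j)\<^sup>2)"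
    unfolding hs_norm_square[OF endoT]
    by (intro sum.cong) (simp_all add: eig endo_inner_simps inner_basis power2_eq_square)
  have "(\<Sum>i=1..l. \<Sum>j=1..dim G. \<Sum>k=1..dim G. w i j k * (\<mu> j - \<mu> k)\<^sup>2)
      \<le> 6 * real l * (\<Sum>j=1..dim G. (\<mu> j)\<^sup>2)"
  proof (rule weighted_gap_sum_le)
    show "w i j k = w j i k" for i j k
      by (simp add: w_def lie_bracket_antisym[of "\<eta>' i" "\<eta>' j"] endo_inner_simps)
    show w23: "w i j k = w i k j" for i j k
      using endo_inner_bracket_skew[OF skew'[of i], of "\<eta>' j" "\<eta>' k"]
      by (simp add: w_def endo_inner_commute[of "\<eta>' j"])
    show "0 \<le> w i j k" for i j k by (simp add: w_def)
    show "w i j j = 0" for i j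
      using endo_inner_bracket_skew[OF skew'[of i], of "\<eta>' j" "\<eta>' j"]
      by (simp add: w_def endo_inner_commute[of "\<eta>' j"])
    show "mono_on {1..dim G} \<mu>" using mono by (simp add: I_def)
    fix i J assume i: "i \<in> {1..dim G}" and J: "J \<subseteq> {1..dim G}" and "i \<notin> J"
    have JI: "j \<in> I" if "j \<in> J" for j using J that by (auto simp: I_def)
    have iI: "i \<in> I" using i by (simp add: I_def)
    have "orthonormal_endos J \<eta>" using orth JI by (simp add: orthonormal_endos_def)
    moreover have "finite J" using J finite_subset by blast
    moreover have "\<eta> i \<in> skew_endos" "\<And>j. j \<in> J \<Longrightarrow> \<eta> j \<in> skew_endos"
      using mem JI iI skew by auto
    ultimately have "(\<Sum>j\<in>J. endo_inner (lie_bracket (\<eta> i) (\<eta> j)) (lie_bracket (\<eta> i) (\<eta> j)))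
       - (\<Sum>j\<in>J. \<Sum>k\<in>J. (endo_inner (lie_bracket (\<eta> i) (\<eta> j)) (\<eta> k))\<^sup>2) / 2 \<le> real (card J) + 1"
      using inner_basis[OF iI iI] by (intro bracket_energy_touching) auto
    then show "(\<Sum>j\<in>J. \<Sum>k=1..dim G. w i j k) - (\<Sum>j\<in>J. \<Sum>k\<in>J. w i j k) / 2 \<le> real (card J) + 1"
      unfolding I_def[symmetric] by (simp add: w_eq iI JI sq[OF br[OF mem mem]] cong: sum.cong)
  qed (rule l)
  then show ?thesis
    unfolding normT using l by (simp add: act I_def)
qed

section \<open>The classical Lie algebras\<close>

lemma mat_op_bracket: "lie_bracket (mat_op A) (mat_op B) = mat_op (A ** B - B ** A)"
  by (rule blinfun_eqI)
    (simp add: lie_bracket_apply mat_op_apply matrix_vector_mul_assoc matrix_vector_mult_diff_rdistrib)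

lemma mat_op_add: "mat_op (A + B) = mat_op A + mat_op B"
  by (rule blinfun_eqI) (simp add: mat_op_apply blinfun.add_left matrix_vector_mult_add_rdistrib)

lemma mat_op_scaleR: "mat_op (c *\<^sub>R A) = c *\<^sub>R mat_op A"
  by (rule blinfun_eqI)
    (simp add: mat_op_apply blinfun.scaleR_left matrix_vector_mult_def vec_eq_iff scaleR_sum_right)

text \<open>
  The three classical algebras at once: \<open>st\<close> is the conjugation of the scalars, an
  anti-automorphism for which multiplication by \<open>st a\<close> is adjoint to multiplication by \<open>a\<close>. The
  subspace \<open>M\<close> accounts for the trace condition of \<open>su(n)\<close>.
\<close>

lemma lie_subalgebra_skew_hermitian:
  fixes st :: "'k \<Rightarrow> 'k::{real_algebra_1,euclidean_space}" and M :: "('k^'n^'n) set"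
  assumes lin: "linear st" and mult: "\<And>x y. st (x * y) = st y * st x"
    and adj: "\<And>a x y. (a * x) \<bullet> y = x \<bullet> (st a * y)"
    and M: "subspace M" and M_bracket: "\<And>A B. A \<in> M \<Longrightarrow> B \<in> M \<Longrightarrow> A ** B - B ** A \<in> M"
  shows "lie_subalgebra (mat_op ` {A. (\<chi> i j. st (A $ j $ i)) = - A \<and> A \<in> M})"
proof -
  define H where "H = {A :: 'k^'n^'n. (\<forall>i j. st (A $ j $ i) = - A $ i $ j) \<and> A \<in> M}"
  have H: "{A. (\<chi> i j. st (A $ j $ i)) = - A \<and> A \<in> M} = H"
    by (auto simp: H_def vec_eq_iff)
  have "subspace H"
    using M by (auto simp: subspace_def H_def linear_0[OF lin] linear_add[OF lin] linear_scale[OF lin])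
  moreover have "linear (mat_op :: 'k^'n^'n \<Rightarrow> _)"
    by (rule linearI) (simp_all add: mat_op_add mat_op_scaleR)
  ultimately have "subspace (mat_op ` H)" by (simp add: linear_subspace_image)
  moreover have "mat_op A \<in> skew_endos" if "A \<in> H" for A
  proof -
    have "(A *v x) \<bullet> y = - (x \<bullet> (A *v y))" for x y :: "'k^'n"
    proof -
      have "(A *v x) \<bullet> y = (\<Sum>i\<in>UNIV. \<Sum>j\<in>UNIV. x $ j \<bullet> (st (A $ i $ j) * y $ i))"
        by (simp add: matrix_vector_mult_def inner_vec_def inner_sum_left adj)
      also have "\<dots> = (\<Sum>j\<in>UNIV. \<Sum>i\<in>UNIV. x $ j \<bullet> (- A $ j $ i * y $ i))"
        using that by (subst sum.swap) (simp add: H_def)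
      also have "\<dots> = - (x \<bullet> (A *v y))"
        by (simp add: matrix_vector_mult_def inner_vec_def inner_sum_right sum_negf)
      finally show ?thesis .
    qed
    then show ?thesis by (simp add: skew_endos_def mat_op_apply)
  qed
  moreover have "lie_bracket (mat_op A) (mat_op B) \<in> mat_op ` H" if "A \<in> H" "B \<in> H" for A B
  proof -
    have st_prod: "st ((P ** Q) $ j $ i) = (Q ** P) $ i $ j" if "P \<in> H" "Q \<in> H" for P Q i j
      using that by (simp add: H_def matrix_matrix_mult_def linear_sum[OF lin] mult)
    have "A ** B - B ** A \<in> H"
      using that M_bracket[of A B] st_prod[OF that] st_prod[OF that(2,1)]
      by (simp add: H_def linear_diff[OF lin])
    then show ?thesis by (simp add: mat_op_bracket)
  qed
  ultimately show ?thesis unfolding H lie_subalgebra_def by blast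
qed

lemma trace_commutator:
  fixes A B :: "('a::comm_ring_1)^'n^'n"
  shows "trace (A ** B - B ** A) = 0"
proof -
  have "trace (A ** B) = trace (B ** A)"
    unfolding trace_def matrix_matrix_mult_def
    by (simp add: mult.commute) (rule sum.swap)
  then show ?thesis by (simp add: trace_def sum_subtractf)
qed

lemma lie_subalgebra_so_alg: "lie_subalgebra so_alg"
  using lie_subalgebra_skew_hermitian[of "\<lambda>x :: real. x" UNIV]
  by (simp add: so_alg_def transpose_def linear_ident)

lemma lie_subalgebra_su_alg: "lie_subalgebra su_alg"
proof -
  have "linear cnj" by (rule linearI) simp_all
  moreover have "(a * x) \<bullet> y = x \<bullet> (cnj a * y)" for a x y
    by (simp add: inner_complex_def algebra_simps)
  moreover have "subspace {A :: complex^'n^'n. trace A = 0}"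
    by (auto simp: subspace_def trace_def sum.distrib scaleR_sum_right[symmetric])
  ultimately show ?thesis
    using lie_subalgebra_skew_hermitian[of cnj "{A :: complex^'n^'n. trace A = 0}"]
    by (simp add: su_alg_def trace_commutator)
qed

lemma lie_subalgebra_sp_alg: "lie_subalgebra sp_alg"
proof -
  have "linear qcnj"
    by (rule linearI) (simp_all add: qcnj_def quat_eq_iff plus_quat_def scaleR_quat_def)
  moreover have "qcnj (x * y) = qcnj y * qcnj x" for x y
    by (simp add: qcnj_def quat_eq_iff times_quat_def algebra_simps)
  moreover have "(a * x) \<bullet> y = x \<bullet> (qcnj a * y)" for a x y :: quat
    by (simp add: qcnj_def inner_quat_def times_quat_def algebra_simps)
  ultimately show ?thesis
    using lie_subalgebra_skew_hermitian[of qcnj UNIV] by (simp add: sp_alg_def)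
qed

theorem proposition3p1:
  shows "(\<forall>(G :: ('v::euclidean_space \<Rightarrow>\<^sub>L 'v) set) T \<eta> \<mu> l.
            lie_subalgebra G \<longrightarrow> self_adjoint_on G T \<longrightarrow> ordered_eigenbasis G T \<eta> \<mu> \<longrightarrow>
            1 \<le> l \<longrightarrow> l \<le> dim G \<longrightarrow>
            (\<Sum>i=1..l. (hs_norm G (lie_act (\<eta> i) T))\<^sup>2) \<le> 6 * real l * (hs_norm G T)\<^sup>2)
       \<and> (lie_subalgebra (so_alg :: ((real^'n) \<Rightarrow>\<^sub>L (real^'n)) set)
          \<and> (\<forall>T \<eta> \<mu> l. let G = (so_alg :: ((real^'n) \<Rightarrow>\<^sub>L (real^'n)) set) in
            self_adjoint_on G T \<longrightarrow> ordered_eigenbasis G T \<eta> \<mu> \<longrightarrow>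
            1 \<le> l \<longrightarrow> l \<le> dim G \<longrightarrow>
            (\<Sum>i=1..l. (hs_norm G (lie_act (\<eta> i) T))\<^sup>2) \<le> 6 * real l * (hs_norm G T)\<^sup>2))
       \<and> (lie_subalgebra (su_alg :: ((complex^'n) \<Rightarrow>\<^sub>L (complex^'n)) set)
          \<and> (\<forall>T \<eta> \<mu> l. let G = (su_alg :: ((complex^'n) \<Rightarrow>\<^sub>L (complex^'n)) set) in
            self_adjoint_on G T \<longrightarrow> ordered_eigenbasis G T \<eta> \<mu> \<longrightarrow>
            1 \<le> l \<longrightarrow> l \<le> dim G \<longrightarrow>
            (\<Sum>i=1..l. (hs_norm G (lie_act (\<eta> i) T))\<^sup>2) \<le> 6 * real l * (hs_norm G T)\<^sup>2))
       \<and> (lie_subalgebra (sp_alg :: ((quat^'n) \<Rightarrow>\<^sub>L (quat^'n)) set)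
          \<and> (\<forall>T \<eta> \<mu> l. let G = (sp_alg :: ((quat^'n) \<Rightarrow>\<^sub>L (quat^'n)) set) in
            self_adjoint_on G T \<longrightarrow> ordered_eigenbasis G T \<eta> \<mu> \<longrightarrow>
            1 \<le> l \<longrightarrow> l \<le> dim G \<longrightarrow>
            (\<Sum>i=1..l. (hs_norm G (lie_act (\<eta> i) T))\<^sup>2) \<le> 6 * real l * (hs_norm G T)\<^sup>2))"
  unfolding Let_def
  by (intro conjI allI impI lie_act_sum_le lie_subalgebra_so_alg lie_subalgebra_su_alg
      lie_subalgebra_sp_alg)

end
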